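(* Let $G$ be a group generated as a monoid by a subset $A\subseteq G$ closed under $G$-conjugation, let $c\in G$ with $A_c$ finite and $n=\ell_A(c)\ge 3$. Assume there exists $a\in A_c$ such that, apart possibly from $a^2$, exactly one element $g_a$ of $\mathcal{P}_c$ covers $a$. Suppose $c=ab^{n-1}$ for some $b\in A$, and $|A_{g_a}|=3$. Then the following holds: if $\mathcal{P}_c$ is totally chain-connected and $\prec$ is a $c$-compatible order of $A_c$, then for every $g\in\mathcal{P}_c$ the reduced cycle graph $\Gamma_{\prec_g}(\mathcal{P}_g)$ induces a linear order, where $\prec_g$ denotes the restriction of $\prec$ to $A_g$.
   Context: For $x\in G$, $\ell_A(x)$ is the least $k\ge 0$ such that $x$ is a product of $k$ elements of $A$; a reduced $A$-factorization is such a product with $k=\ell_A(x)$, written as a tuple. $x\le_A y$ iff $\ell_A(x)+\ell_A(x^{-1}y)=\ell_A(y)$; $\mathcal{P}_g=[e,g]_A$ ordered by $\le_A$, $A_g=\{d\in A: d\le_A g\}$, $R_g=\{h: h\le_A g,\ \ell_A(h)=2\}$. The chain graph of a bounded graded poset has maximal chains as vertices, adjacent when they differ in exactly one element; the poset is chain-connected if this graph is connected and totally chain-connected if every interval is chain-connected. A linear order $\prec$ on $A_c$ is $c$-compatible if every $h\in R_c$ has exactly one reduced $A$-factorization $(x,y)$ with $x\preceq y$. The cycle graph $\Gamma(\mathcal{P}_g)$ has vertex set $A_g$ and a directed edge $x\to y$ (possibly a loop) labeled $xy$ whenever $xy\in R_g$. For a linear order $\prec'$ of $A_g$, the reduced cycle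 graph $\Gamma_{\prec'}(\mathcal{P}_g)$ is obtained by removing the edges $x\to y$ with $x\preceq' y$. A directed graph induces a linear order if the relation "$u=v$ or there is a directed path from $u$ to $v$" is a total order on its vertices.
   Formalization: The formal statement additionally assumes that the identity e is not in A; if e ∈ A, then e is an isolated vertex of every cycle graph and the claim fails. *)

theory Defs
  imports "HOL-Algebra.Group" "Graph_Theory.Digraph_Component"
begin

text \<open>
  A poset is given by its set \<open>P\<close> of elements and a binary relation \<open>leq\<close>, of which only the
  restriction to \<open>P\<close> matters.
\<close>

definition covered_by :: "'a set \<Rightarrow> ('a \<Rightarrow> 'a \<Rightarrow> bool) \<Rightarrow> 'a \<Rightarrow> 'a \<Rightarrow> bool" where
  "covered_by P leq x y \<longleftrightarrow> x \<in> P \<and> y \<in> P \<and> leq x y \<and> x \<noteq> y \<and>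
     (\<forall>z\<in>P. leq x z \<and> leq z y \<longrightarrow> z = x \<or> z = y)"

definition poset_interval :: "'a set \<Rightarrow> ('a \<Rightarrow> 'a \<Rightarrow> bool) \<Rightarrow> 'a \<Rightarrow> 'a \<Rightarrow> 'a set" where
  "poset_interval P leq x y = {z \<in> P. leq x z \<and> leq z y}"

text \<open>
  In a bounded graded poset all maximal chains are finite of the same cardinality, so two of
  them differ in exactly one element if each contains exactly one element that the other does
  not. The edges are undirected; they are encoded as a symmetric set of pairs.
\<close>

definition chain_graph ::
    "'a set \<Rightarrow> ('a \<Rightarrow> 'a \<Rightarrow> bool) \<Rightarrow> ('a set, 'a set \<times> 'a set) pre_digraph" where
  "chain_graph P leq =
     \<lparr>verts = {C. pred_on.maxchain P leq C},
      arcs = {(C, D). pred_on.maxchain P leq C \<and> pred_on.maxchain P leq D \<and>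
                      card (C - D) = 1 \<and> card (D - C) = 1},
      tail = fst, head = snd\<rparr>"

definition chain_connected :: "'a set \<Rightarrow> ('a \<Rightarrow> 'a \<Rightarrow> bool) \<Rightarrow> bool" where
  "chain_connected P leq \<longleftrightarrow> Digraph_Component.connected (chain_graph P leq)"

definition totally_chain_connected :: "'a set \<Rightarrow> ('a \<Rightarrow> 'a \<Rightarrow> bool) \<Rightarrow> bool" where
  "totally_chain_connected P leq \<longleftrightarrow>
     (\<forall>x\<in>P. \<forall>y\<in>P. leq x y \<longrightarrow> chain_connected (poset_interval P leq x y) leq)"

definition word_prod :: "('a, 'm) monoid_scheme \<Rightarrow> 'a list \<Rightarrow> 'a" where
  "word_prod G xs = foldr (\<otimes>\<^bsub>G\<^esub>) xs \<one>\<^bsub>G\<^esub>"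

definition generated_as_monoid_by :: "('a, 'm) monoid_scheme \<Rightarrow> 'a set \<Rightarrow> bool" where
  "generated_as_monoid_by G A \<longleftrightarrow>
     A \<subseteq> carrier G \<and> (\<forall>x\<in>carrier G. \<exists>xs. set xs \<subseteq> A \<and> word_prod G xs = x)"

definition conjugation_closed :: "('a, 'm) monoid_scheme \<Rightarrow> 'a set \<Rightarrow> bool" where
  "conjugation_closed G A \<longleftrightarrow>
     (\<forall>g\<in>carrier G. \<forall>x\<in>A. inv\<^bsub>G\<^esub> g \<otimes>\<^bsub>G\<^esub> x \<otimes>\<^bsub>G\<^esub> g \<in> A)"

definition word_length :: "('a, 'm) monoid_scheme \<Rightarrow> 'a set \<Rightarrow> 'a \<Rightarrow> nat" where
  "word_length G A x =
     (LEAST k. \<exists>xs. length xs = k \<and> set xs \<subseteq> A \<and> word_prod G xs = x)"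

definition reduced_factorization ::
    "('a, 'm) monoid_scheme \<Rightarrow> 'a set \<Rightarrow> 'a \<Rightarrow> 'a list \<Rightarrow> bool" where
  "reduced_factorization G A x xs \<longleftrightarrow>
     set xs \<subseteq> A \<and> word_prod G xs = x \<and> length xs = word_length G A x"

definition prefix_le :: "('a, 'm) monoid_scheme \<Rightarrow> 'a set \<Rightarrow> 'a \<Rightarrow> 'a \<Rightarrow> bool" where
  "prefix_le G A x y \<longleftrightarrow>
     word_length G A x + word_length G A (inv\<^bsub>G\<^esub> x \<otimes>\<^bsub>G\<^esub> y) = word_length G A y"

definition factorization_poset :: "('a, 'm) monoid_scheme \<Rightarrow> 'a set \<Rightarrow> 'a \<Rightarrow> 'a set" where
  "factorization_poset G A g = poset_interval (carrier G) (prefix_le G A) \<one>\<^bsub>G\<^esub> g"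

definition gens_below :: "('a, 'm) monoid_scheme \<Rightarrow> 'a set \<Rightarrow> 'a \<Rightarrow> 'a set" where
  "gens_below G A g = {d \<in> A. prefix_le G A d g}"

definition rank_two_below :: "('a, 'm) monoid_scheme \<Rightarrow> 'a set \<Rightarrow> 'a \<Rightarrow> 'a set" where
  "rank_two_below G A g = {h \<in> carrier G. prefix_le G A h g \<and> word_length G A h = 2}"

text \<open>Linear orders are reflexive relations: \<open>(x, y) \<in> r\<close> stands for \<open>x \<preceq> y\<close>.\<close>

definition compatible_order ::
    "('a, 'm) monoid_scheme \<Rightarrow> 'a set \<Rightarrow> 'a \<Rightarrow> 'a rel \<Rightarrow> bool" where
  "compatible_order G A c r \<longleftrightarrow> linear_order_on (gens_below G A c) r \<and>
     (\<forall>h\<in>rank_two_below G A c.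
        \<exists>!p. reduced_factorization G A h [fst p, snd p] \<and> (fst p, snd p) \<in> r)"

text \<open>An arc \<open>(x, h, y)\<close> is the edge from \<open>x\<close> to \<open>y\<close> with label \<open>h\<close>.\<close>

definition cycle_graph ::
    "('a, 'm) monoid_scheme \<Rightarrow> 'a set \<Rightarrow> 'a \<Rightarrow> ('a, 'a \<times> 'a \<times> 'a) pre_digraph" where
  "cycle_graph G A g =
     \<lparr>verts = gens_below G A g,
      arcs = {(x, h, y). x \<in> gens_below G A g \<and> y \<in> gens_below G A g \<and>
                         h = x \<otimes>\<^bsub>G\<^esub> y \<and> h \<in> rank_two_below G A g},
      tail = (\<lambda>(x, h, y). x), head = (\<lambda>(x, h, y). y)\<rparr>"

definition reduced_cycle_graph ::
    "('a, 'm) monoid_scheme \<Rightarrow> 'a set \<Rightarrow> 'a rel \<Rightarrow> 'a \<Rightarrow> ('a, 'a \<times> 'a \<times> 'a) pre_digraph" where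
  "reduced_cycle_graph G A r g =
     (cycle_graph G A g)
       \<lparr>arcs := {e \<in> arcs (cycle_graph G A g).
                  (tail (cycle_graph G A g) e, head (cycle_graph G A g) e) \<notin> r}\<rparr>"

definition induces_linear_order :: "('v, 'e) pre_digraph \<Rightarrow> bool" where
  "induces_linear_order D \<longleftrightarrow> linear_order_on (verts D) {(u, v). u \<rightarrow>\<^sup>*\<^bsub>D\<^esub> v}"

end

theory Submission
  imports Defs
begin

text \<open>
  Write \<open>a\<^sub>0 = a\<close> and \<open>a\<^sub>i = b\<inverse> a\<^sub>i\<^sub>-\<^sub>1 b\<close>. Compatibility allows only one weak ascent among the
  factorizations of each element of length two. This forces \<open>a \<noteq> b\<close>, \<open>g\<^sub>a = ab\<close> and the braid
  relation \<open>ab = ba\<^sub>1 = a\<^sub>1a\<close>, while the unique cover makes \<open>b\<close> the only atom of \<open>b\<^sup>n\<^sup>-\<^sup>1\<close>.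

  If \<open>n \<ge> 5\<close>, conjugation by \<open>ab\<^sup>4\<close> fixes \<open>a\<^sub>2\<close> and sends \<open>b\<close> along a sequence \<open>y\<^sub>k\<close> such that
  \<open>(a\<^sub>2, y\<^sub>k, y\<^sub>k\<^sub>+\<^sub>1)\<close> satisfy the braid relation \<open>a\<^sub>2y\<^sub>k = y\<^sub>ky\<^sub>k\<^sub>+\<^sub>1 = y\<^sub>k\<^sub>+\<^sub>1a\<^sub>2\<close>;
  the order would then descend forever. Hence
  \<open>n \<le> 4\<close>, and chain-connectivity determines the atoms: \<open>a, b, a\<^sub>2, a\<^sub>1\<close> for \<open>n = 3\<close> and
  \<open>a, b, a\<^sub>3, a\<^sub>2, e, a\<^sub>1\<close> for \<open>n = 4\<close>, where \<open>e = c\<inverse> a\<^sub>3 c\<close>. Listed in this way they form a directed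
  cycle of the cycle graph. The cycle is glued from triangles, each with a single ascent,
  so it has a single ascent itself, and removing that edge leaves a Hamiltonian path of the
  reduced cycle graph. Elements of length three are conjugates of \<open>b\<^sup>3\<close> or of \<open>ab\<^sup>2\<close>.
\<close>

subsection \<open>Conjugation, length and the prefix order\<close>

locale conj_gen_group = group G for G :: "('a, 'm) monoid_scheme" (structure) +
  fixes A :: "'a set"
  assumes generated: "generated_as_monoid_by G A"
    and one_notin: "\<one> \<notin> A"
    and conj_closed: "conjugation_closed G A"
begin

abbreviation len :: "'a \<Rightarrow> nat" where "len \<equiv> word_length G A"
abbreviation below :: "'a \<Rightarrow> 'a \<Rightarrow> bool" (infix "\<preceq>" 50) where "x \<preceq> y \<equiv> prefix_le G A x y"
abbreviation atoms :: "'a \<Rightarrow> 'a set" where "atoms \<equiv> gens_below G A"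
abbreviation ranktwo :: "'a \<Rightarrow> 'a set" where "ranktwo \<equiv> rank_two_below G A"

text \<open>Conjugation as a right action: \<open>cj (u \<otimes> v)\<close> applies
  \<open>cj u\<close> first. By \<open>x \<otimes> u = u \<otimes> cj u x\<close> it is the change
  that a letter undergoes when \<open>u\<close> moves past it to the left.\<close>

definition cj :: "'a \<Rightarrow> 'a \<Rightarrow> 'a" where "cj u x = inv u \<otimes> x \<otimes> u"

lemma A_carrier: "x \<in> A \<Longrightarrow> x \<in> carrier G"
  using generated by (auto simp: generated_as_monoid_by_def)

lemma cj_closed [simp]: "u \<in> carrier G \<Longrightarrow> x \<in> carrier G \<Longrightarrow> cj u x \<in> carrier G"
  by (simp add: cj_def)

lemma cj_in_A: "u \<in> carrier G \<Longrightarrow> x \<in> A \<Longrightarrow> cj u x \<in> A"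
  using conj_closed by (auto simp: conjugation_closed_def cj_def)

lemma cj_one [simp]: "u \<in> carrier G \<Longrightarrow> cj u \<one> = \<one>"
  by (simp add: cj_def)

lemma cj_mult:
  assumes "u \<in> carrier G" "x \<in> carrier G" "y \<in> carrier G"
  shows "cj u (x \<otimes> y) = cj u x \<otimes> cj u y"
proof -
  have "cj u x \<otimes> cj u y = inv u \<otimes> x \<otimes> (u \<otimes> (inv u \<otimes> (y \<otimes> u)))"
    using assms by (simp add: cj_def m_assoc)
  also have "u \<otimes> (inv u \<otimes> (y \<otimes> u)) = y \<otimes> u"
    using assms by (simp add: m_assoc[symmetric])
  finally show ?thesis using assms by (simp add: cj_def m_assoc)
qed

lemma cj_cj:
  assumes "u \<in> carrier G" "v \<in> carrier G" "x \<in> carrier G"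
  shows "cj v (cj u x) = cj (u \<otimes> v) x"
  using assms by (simp add: cj_def m_assoc inv_mult_group)

lemma cj_inv [simp]:
  assumes "u \<in> carrier G" "x \<in> carrier G"
  shows "cj (inv u) (cj u x) = x" "cj u (cj (inv u) x) = x"
  using assms by (simp_all add: cj_cj) (simp_all add: cj_def)

lemma inv_cj: "u \<in> carrier G \<Longrightarrow> x \<in> carrier G \<Longrightarrow> inv (cj u x) = cj u (inv x)"
  by (simp add: cj_def inv_mult_group m_assoc)

lemma cj_inject:
  "u \<in> carrier G \<Longrightarrow> x \<in> carrier G \<Longrightarrow> y \<in> carrier G \<Longrightarrow> cj u x = cj u y \<longleftrightarrow> x = y"
  by (metis cj_inv(1))

lemma cj_self [simp]: "u \<in> carrier G \<Longrightarrow> cj u u = u"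
  by (simp add: cj_def)

lemma cj_eqI:
  assumes "u \<in> carrier G" "x \<in> carrier G" "y \<in> carrier G" "x \<otimes> u = u \<otimes> y"
  shows "cj u x = y"
  using assms by (metis cj_def inv_closed l_inv l_one m_assoc)

lemma mult_cj: "u \<in> carrier G \<Longrightarrow> x \<in> carrier G \<Longrightarrow> u \<otimes> cj u x = x \<otimes> u"
  by (simp add: cj_def m_assoc[symmetric])

text \<open>Conjugation by \<open>w\<close> is an automorphism, so it commutes with forming
  conjugates. Later this yields its value on one letter from its values on others.\<close>

lemma cj_of_cj:
  assumes "w \<in> carrier G" "u \<in> carrier G" "x \<in> carrier G"
  shows "cj w (cj u x) = cj (cj w u) (cj w x)"
  using assms by (simp add: cj_def[of u x] cj_def[of "cj w u"] cj_mult inv_cj)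

section \<open>Words over the generators and their length\<close>

lemma word_prod_Nil [simp]: "word_prod G [] = \<one>"
  by (simp add: word_prod_def)

lemma word_prod_Cons [simp]: "word_prod G (x # xs) = x \<otimes> word_prod G xs"
  by (simp add: word_prod_def)

lemma word_prod_closed: "set xs \<subseteq> A \<Longrightarrow> word_prod G xs \<in> carrier G"
  by (induction xs) (auto simp: A_carrier)

lemma word_prod_append:
  "set xs \<subseteq> A \<Longrightarrow> set ys \<subseteq> A \<Longrightarrow> word_prod G (xs @ ys) = word_prod G xs \<otimes> word_prod G ys"
  by (induction xs) (auto simp: A_carrier word_prod_closed m_assoc)

lemma word_prod_cj:
  "u \<in> carrier G \<Longrightarrow> set xs \<subseteq> A \<Longrightarrow> word_prod G (map (cj u) xs) = cj u (word_prod G xs)"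
  by (induction xs) (auto simp: A_carrier word_prod_closed cj_mult)

lemma len_le: "set xs \<subseteq> A \<Longrightarrow> word_prod G xs = x \<Longrightarrow> len x \<le> length xs"
  unfolding word_length_def by (rule Least_le) blast

lemma reduced_exists:
  assumes "x \<in> carrier G"
  obtains xs where "set xs \<subseteq> A" "word_prod G xs = x" "length xs = len x"
proof -
  have "\<exists>k xs. length xs = k \<and> set xs \<subseteq> A \<and> word_prod G xs = x"
    using generated assms by (auto simp: generated_as_monoid_by_def)
  from LeastI_ex[OF this] show thesis using that by (auto simp: word_length_def)
qed

lemma len_mult_le:
  assumes "x \<in> carrier G" "y \<in> carrier G"
  shows "len (x \<otimes> y) \<le> len x + len y"
proof -
  obtain xs where xs: "set xs \<subseteq> A" "word_prod G xs = x" "length xs = len x"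
    using reduced_exists[OF assms(1)] .
  obtain ys where ys: "set ys \<subseteq> A" "word_prod G ys = y" "length ys = len y"
    using reduced_exists[OF assms(2)] .
  have "len (x \<otimes> y) \<le> length (xs @ ys)"
    by (rule len_le) (use xs ys in \<open>auto simp: word_prod_append\<close>)
  then show ?thesis using xs ys by simp
qed

lemma len_one [simp]: "len \<one> = 0"
  using len_le[of "[]"] by simp

lemma len_eq_0: "x \<in> carrier G \<Longrightarrow> len x = 0 \<Longrightarrow> x = \<one>"
  by (metis length_0_conv reduced_exists word_prod_Nil)

lemma len_A [simp]:
  assumes "x \<in> A"
  shows "len x = 1"
proof -
  have "len x \<le> 1" using len_le[of "[x]"] assms by (simp add: A_carrier)
  moreover have "len x \<noteq> 0" using len_eq_0[OF A_carrier[OF assms]] assms one_notin by auto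
  ultimately show ?thesis by simp
qed

lemma len_eq_1:
  assumes "x \<in> carrier G" "len x = 1"
  shows "x \<in> A"
proof -
  obtain xs where xs: "set xs \<subseteq> A" "word_prod G xs = x" "length xs = len x"
    using reduced_exists[OF assms(1)] .
  with assms(2) obtain y where "xs = [y]" by (metis One_nat_def length_0_conv length_Suc_conv)
  with xs show ?thesis by (auto simp: A_carrier)
qed

lemma len_cj [simp]:
  assumes "u \<in> carrier G" "x \<in> carrier G"
  shows "len (cj u x) = len x"
proof -
  \<comment> \<open>Conjugating letter by letter keeps a word over \<open>A\<close> and its number
    of letters. Used for \<open>u\<close> and for \<open>inv u\<close>, the inequality gives
    equality.\<close>
  have le: "len (cj u x) \<le> len x" if ux: "u \<in> carrier G" "x \<in> carrier G" for u x
  proof -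
    obtain xs where xs: "set xs \<subseteq> A" "word_prod G xs = x" "length xs = len x"
      using reduced_exists[OF ux(2)] .
    have "len (cj u x) \<le> length (map (cj u) xs)"
      by (rule len_le) (use xs ux in \<open>auto simp: word_prod_cj intro: cj_in_A\<close>)
    then show ?thesis using xs by simp
  qed
  from le[OF assms] le[of "inv u" "cj u x"] assms show ?thesis by simp
qed

lemma inv_mult_cancel: "u \<in> carrier G \<Longrightarrow> v \<in> carrier G \<Longrightarrow> inv u \<otimes> (u \<otimes> v) = v"
  by (simp add: m_assoc[symmetric])

lemma mult_inv_cancel: "u \<in> carrier G \<Longrightarrow> v \<in> carrier G \<Longrightarrow> u \<otimes> (inv u \<otimes> v) = v"
  by (simp add: m_assoc[symmetric])

section \<open>The prefix order and its symmetries\<close>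

lemma below_mult_iff:
  assumes "u \<in> carrier G" "v \<in> carrier G"
  shows "u \<preceq> u \<otimes> v \<longleftrightarrow> len (u \<otimes> v) = len u + len v"
  using assms by (auto simp: prefix_le_def inv_mult_cancel)

text \<open>Taking \<open>v\<close> out on the left leaves \<open>cj v u\<close>, which is as long
  as \<open>u\<close>. Thus a suffix of a length-additive product is also a prefix.\<close>

lemma below_mult_suffix_iff:
  assumes "u \<in> carrier G" "v \<in> carrier G"
  shows "v \<preceq> u \<otimes> v \<longleftrightarrow> len (u \<otimes> v) = len u + len v"
proof -
  have "inv v \<otimes> (u \<otimes> v) = cj v u" using assms by (simp add: cj_def m_assoc)
  then show ?thesis using assms by (auto simp: prefix_le_def)
qed

lemma belowE:
  assumes "x \<preceq> y" "x \<in> carrier G" "y \<in> carrier G"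
  obtains z where "z \<in> carrier G" "y = x \<otimes> z" "len y = len x + len z"
  using that[of "inv x \<otimes> y"] assms by (auto simp: prefix_le_def mult_inv_cancel)

lemma below_refl [simp]: "x \<in> carrier G \<Longrightarrow> x \<preceq> x"
  by (simp add: prefix_le_def)

lemma one_below [simp]: "x \<in> carrier G \<Longrightarrow> \<one> \<preceq> x"
  by (simp add: prefix_le_def)

lemma below_len: "x \<preceq> y \<Longrightarrow> len x \<le> len y"
  by (simp add: prefix_le_def)

lemma below_trans:
  assumes "x \<preceq> y" "y \<preceq> z" "x \<in> carrier G" "y \<in> carrier G" "z \<in> carrier G"
  shows "x \<preceq> z"
proof -
  obtain v where v: "v \<in> carrier G" "y = x \<otimes> v" "len y = len x + len v"
    using belowE[OF assms(1,3,4)] .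
  obtain w where w: "w \<in> carrier G" "z = y \<otimes> w" "len z = len y + len w"
    using belowE[OF assms(2,4,5)] .
  have z: "z = x \<otimes> (v \<otimes> w)" using v w assms by (simp add: m_assoc)
  have "len z \<le> len x + len (v \<otimes> w)" unfolding z using v w assms by (simp add: len_mult_le)
  moreover have "len (v \<otimes> w) \<le> len v + len w" using v w by (simp add: len_mult_le)
  ultimately have "len z = len x + len (v \<otimes> w)" using v w by simp
  then show ?thesis using z v w assms by (simp add: below_mult_iff)
qed

lemma below_eq_len:
  assumes "x \<preceq> y" "x \<in> carrier G" "y \<in> carrier G" "len x = len y"
  shows "x = y"
  using belowE[OF assms(1-3)] assms(2,4) by (metis add_0_right add_left_cancel len_eq_0 r_one)

text \<open>The lengths of \<open>u\<close>, \<open>y\<close> and the rest of \<open>v\<close> add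
  up to that of the whole product, so no partial product can be shorter than expected.\<close>

lemma below_mult_mono:
  assumes "u \<in> carrier G" "v \<in> carrier G" "y \<in> carrier G" "u \<preceq> u \<otimes> v" "y \<preceq> v"
  shows "u \<otimes> y \<preceq> u \<otimes> v" "len (u \<otimes> y) = len u + len y"
proof -
  obtain w where w: "w \<in> carrier G" "v = y \<otimes> w" "len v = len y + len w"
    using belowE[OF assms(5,3,2)] .
  have uv: "u \<otimes> v = (u \<otimes> y) \<otimes> w" using w assms by (simp add: m_assoc)
  have 1: "len (u \<otimes> v) = len u + len y + len w" using assms w by (simp add: below_mult_iff)
  have 2: "len (u \<otimes> v) \<le> len (u \<otimes> y) + len w" using uv w assms by (simp add: len_mult_le)
  have 3: "len (u \<otimes> y) \<le> len u + len y" using assms by (simp add: len_mult_le)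
  show "len (u \<otimes> y) = len u + len y" using 1 2 3 by simp
  then show "u \<otimes> y \<preceq> u \<otimes> v" using uv w assms 1 by (simp add: below_mult_iff)
qed

lemma below_mult_cancel:
  assumes "u \<in> carrier G" "v \<in> carrier G" "y \<in> carrier G"
    and "u \<preceq> u \<otimes> v" "u \<otimes> y \<preceq> u \<otimes> v" "len (u \<otimes> y) = len u + len y"
  shows "y \<preceq> v"
proof -
  have "inv (u \<otimes> y) \<otimes> (u \<otimes> v) = inv y \<otimes> v"
    using assms by (simp add: inv_mult_group m_assoc inv_mult_cancel)
  then show ?thesis using assms by (simp add: prefix_le_def inv_mult_cancel)
qed

lemma below_cj_iff:
  assumes "u \<in> carrier G" "x \<in> carrier G" "y \<in> carrier G"
  shows "cj u x \<preceq> cj u y \<longleftrightarrow> x \<preceq> y"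
proof -
  have "inv (cj u x) \<otimes> cj u y = cj u (inv x \<otimes> y)"
    using assms by (simp add: inv_cj cj_mult)
  then show ?thesis using assms by (simp add: prefix_le_def)
qed

lemma atoms_cj:
  assumes "u \<in> carrier G" "g \<in> carrier G"
  shows "atoms (cj u g) = cj u ` atoms g"
proof (intro equalityI subsetI)
  fix x assume x: "x \<in> atoms (cj u g)"
  then have xA: "x \<in> A" "x \<in> carrier G" by (auto simp: gens_below_def A_carrier)
  have "cj (inv u) x \<in> atoms g"
    using x xA assms below_cj_iff[of u "cj (inv u) x" g]
    by (auto simp: gens_below_def intro: cj_in_A)
  moreover have "x = cj u (cj (inv u) x)" using xA assms by simp
  ultimately show "x \<in> cj u ` atoms g" by blast
next
  fix x assume "x \<in> cj u ` atoms g"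
  then show "x \<in> atoms (cj u g)"
    using assms by (auto simp: gens_below_def A_carrier below_cj_iff intro: cj_in_A)
qed

lemma ranktwo_cj_iff:
  assumes "u \<in> carrier G" "g \<in> carrier G" "h \<in> carrier G"
  shows "cj u h \<in> ranktwo (cj u g) \<longleftrightarrow> h \<in> ranktwo g"
  using assms by (auto simp: rank_two_below_def below_cj_iff)

lemma atoms_mono:
  assumes "x \<preceq> y" "x \<in> carrier G" "y \<in> carrier G"
  shows "atoms x \<subseteq> atoms y" "ranktwo x \<subseteq> ranktwo y"
  using assms by (auto simp: gens_below_def rank_two_below_def A_carrier intro: below_trans)

lemma factorization_poset_eq: "factorization_poset G A g = {h \<in> carrier G. h \<preceq> g}"
  by (auto simp: factorization_poset_def poset_interval_def)

text \<open>An upper bound on the length of \<open>w\<close> is enough: subadditivity and the full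
  length of the product make it an equality.\<close>

lemma prefix_atom:
  assumes "x \<in> A" "w \<in> carrier G" "len w \<le> k" "len (x \<otimes> w) = Suc k"
  shows "x \<in> atoms (x \<otimes> w)"
  using assms len_mult_le[of x w] by (auto simp: gens_below_def A_carrier below_mult_iff)

lemma atoms_nonempty:
  assumes "z \<in> carrier G" "z \<noteq> \<one>"
  shows "\<exists>d. d \<in> atoms z"
proof -
  obtain zs where zs: "set zs \<subseteq> A" "word_prod G zs = z" "length zs = len z"
    using reduced_exists[OF assms(1)] .
  then obtain d ds where d: "zs = d # ds" using assms(2) by (cases zs) auto
  have "d \<in> atoms (d \<otimes> word_prod G ds)"
    using zs d by (intro prefix_atom[of _ _ "length ds"]) (auto simp: word_prod_closed len_le)
  then show ?thesis using zs d by auto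
qed

lemma covered_by_mult:
  assumes "x \<in> carrier G" "y \<in> A" "g \<in> carrier G" "x \<otimes> y \<preceq> g" "len (x \<otimes> y) = Suc (len x)"
  shows "covered_by (factorization_poset G A g) below x (x \<otimes> y)"
proof -
  have yc: "y \<in> carrier G" using assms A_carrier by blast
  have xy: "x \<preceq> x \<otimes> y" using assms yc by (simp add: below_mult_iff)
  have "z = x \<or> z = x \<otimes> y" if "z \<in> carrier G" "x \<preceq> z" "z \<preceq> x \<otimes> y" for z
    using below_len[OF that(2)] below_len[OF that(3)] below_eq_len[OF that(2)] below_eq_len[OF that(3)]
      that(1) assms(1,5) yc by (metis le_SucE le_antisym m_closed)
  moreover have "x \<noteq> x \<otimes> y" using assms(5) by auto
  moreover have "x \<preceq> g" using below_trans[OF xy] assms yc by simp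
  ultimately show ?thesis using xy assms yc by (auto simp: covered_by_def factorization_poset_eq)
qed

subsection \<open>Atoms in a chain-connected factorization poset\<close>

text \<open>A maximal chain skips no length: a gap after \<open>u\<close> could be filled by
  \<open>u\<close> times an atom of the quotient to the next element.\<close>

lemma maxchain_has_cover:
  assumes g: "g \<in> carrier G"
    and C: "pred_on.maxchain (factorization_poset G A g) below C"
    and u: "u \<in> C" "len u < len g"
  shows "\<exists>v\<in>C. u \<preceq> v \<and> len v = len u + 1"
proof -
  let ?P = "factorization_poset G A g"
  have ch: "pred_on.chain ?P below C" and mx: "\<And>D. pred_on.chain ?P below D \<Longrightarrow> C \<subseteq> D \<Longrightarrow> D = C"
    using C by (auto simp: pred_on.maxchain_def)
  have CP: "x \<in> carrier G" "x \<preceq> g" if "x \<in> C" for x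
    using ch that by (auto simp: pred_on.chain_def factorization_poset_eq)
  have tot: "x \<preceq> y \<or> y \<preceq> x" if "x \<in> C" "y \<in> C" for x y
    using ch that CP below_refl unfolding pred_on.chain_def by blast
  have ins: "w \<in> C" if "w \<in> carrier G" "w \<preceq> g" "\<And>x. x \<in> C \<Longrightarrow> x \<preceq> w \<or> w \<preceq> x" for w
  proof -
    have "pred_on.chain ?P below (insert w C)"
      using that CP tot unfolding pred_on.chain_def factorization_poset_eq by blast
    from mx[OF this] show ?thesis by blast
  qed
  have "g \<in> C" using ins[of g] g CP by auto
  \<comment> \<open>The next chain element above \<open>u\<close>; the candidates include
    \<open>g\<close>, so the minimum exists.\<close>
  define v where "v = arg_min len (\<lambda>v. v \<in> C \<and> len u < len v)"
  have v: "v \<in> C" "len u < len v" and vmin: "\<And>x. x \<in> C \<Longrightarrow> len u < len x \<Longrightarrow> len v \<le> len x"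
    using arg_min_nat_lemma[of "\<lambda>v. v \<in> C \<and> len u < len v" g len] \<open>g \<in> C\<close> u
    by (auto simp: v_def)
  have uv: "u \<preceq> v" using tot[OF u(1) v(1)] v(2) below_len by force
  obtain z where z: "z \<in> carrier G" "v = u \<otimes> z" "len v = len u + len z"
    using belowE[OF uv] CP u v by blast
  have "z \<noteq> \<one>" using z v by auto
  then obtain d where d: "d \<in> atoms z" using atoms_nonempty z by blast
  have dA: "d \<in> A" "d \<in> carrier G" and dz: "d \<preceq> z"
    using d by (auto simp: gens_below_def A_carrier)
  \<comment> \<open>It lies between \<open>u\<close> and \<open>v\<close>, which are consecutive in
    \<open>C\<close>, so it is comparable with all of \<open>C\<close> and belongs to it by
    maximality.\<close>
  define w where "w = u \<otimes> d"
  have wv: "w \<preceq> v" and wl: "len w = len u + 1"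
    using below_mult_mono[of u z d] z dA dz CP u uv by (auto simp: w_def)
  have wc: "w \<in> carrier G" using CP u dA by (simp add: w_def)
  have uw: "u \<preceq> w" using wl dA CP u by (simp add: w_def below_mult_iff)
  have "w \<in> C"
  proof (rule ins)
    show "w \<preceq> g" using below_trans[OF wv] CP v wc g by blast
    fix x assume x: "x \<in> C"
    show "x \<preceq> w \<or> w \<preceq> x"
    proof (cases "len u < len x")
      case True
      then have "len v \<le> len x" using vmin x by blast
      then have "v \<preceq> x" using tot[OF x v(1)] below_len below_eq_len CP x v by (metis below_refl le_antisym)
      then show ?thesis using below_trans[OF wv] wc CP x v by blast
    next
      case False
      then have "x \<preceq> u" using tot[OF x u(1)] below_len below_eq_len CP x u by (metis below_refl le_antisym not_le)
      then show ?thesis using below_trans[OF _ uw] wc CP x u by blast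
    qed
  qed (fact wc)
  then show ?thesis using uw wl by blast
qed

text \<open>The Hausdorff principle is applied to the elements comparable with \<open>x\<close>. A
  maximal chain there must contain \<open>x\<close>, and any larger chain in the full poset would
  again consist of such elements.\<close>

lemma maxchain_through:
  assumes g: "g \<in> carrier G" and x: "x \<in> carrier G" "x \<preceq> g"
  shows "\<exists>C. pred_on.maxchain (factorization_poset G A g) below C \<and> x \<in> C"
proof -
  let ?P = "factorization_poset G A g"
  let ?Q = "{z \<in> ?P. z \<preceq> x \<or> x \<preceq> z}"
  obtain C where C: "pred_on.maxchain ?Q below C" using pred_on.Hausdorff by blast
  have ch: "pred_on.chain ?Q below C" and mx: "\<And>D. pred_on.chain ?Q below D \<Longrightarrow> C \<subseteq> D \<Longrightarrow> D = C"
    using C by (auto simp: pred_on.maxchain_def)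
  have "pred_on.chain ?Q below (insert x C)"
    using ch x by (auto simp: pred_on.chain_def factorization_poset_eq)
  from mx[OF this] have xC: "x \<in> C" by blast
  have "pred_on.maxchain ?P below C"
    unfolding pred_on.maxchain_def
  proof (intro conjI notI)
    show "pred_on.chain ?P below C" using ch by (auto simp: pred_on.chain_def)
    assume "\<exists>S. pred_on.chain ?P below S \<and> C \<subset> S"
    then obtain D where D: "pred_on.chain ?P below D" "C \<subset> D" by blast
    then have "pred_on.chain ?Q below D" using xC x below_refl unfolding pred_on.chain_def by blast
    with mx[OF this] D show False by blast
  qed
  with xC show ?thesis by blast
qed

text \<open>
  Along an edge of the chain graph either the rank-one or the rank-two element of a maximal
  chain survives, so having its rank-one element in \<open>S\<close> is invariant.
\<close>

lemma atoms_eq_of_closed: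
  assumes g: "g \<in> carrier G"
    and conn: "chain_connected (factorization_poset G A g) below"
    and len2: "2 \<le> len g"
    and S: "S \<subseteq> atoms g" "S \<noteq> {}"
    and closed: "\<And>s h. s \<in> S \<Longrightarrow> h \<in> ranktwo g \<Longrightarrow> s \<preceq> h \<Longrightarrow> atoms h \<subseteq> S"
  shows "atoms g = S"
proof -
  let ?P = "factorization_poset G A g"
  let ?max = "pred_on.maxchain ?P below"
  have ch: "pred_on.chain ?P below C" if "?max C" for C
    using that by (simp add: pred_on.maxchain_def)
  have CP: "x \<in> carrier G" "x \<preceq> g" if "?max C" "x \<in> C" for x C
    using ch[OF that(1)] that(2) by (auto simp: pred_on.chain_def factorization_poset_eq)
  have tot: "x \<preceq> y \<or> y \<preceq> x" if "?max C" "x \<in> C" "y \<in> C" for x y C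
    using ch[OF that(1)] that(2,3) CP[OF that(1)] below_refl unfolding pred_on.chain_def by blast
  have one: "\<one> \<in> C" if C: "?max C" for C
  proof -
    have "pred_on.chain ?P below (insert \<one> C)"
      using ch[OF C] g by (auto simp: pred_on.chain_def factorization_poset_eq)
    then show ?thesis using C unfolding pred_on.maxchain_def by (metis insert_absorb psubsetI subset_insertI insertI1)
  qed
  have rank1: "\<exists>x\<in>C. x \<in> atoms g" if C: "?max C" for C
  proof -
    obtain v where "v \<in> C" "len v = 1" using maxchain_has_cover[OF g C one[OF C]] len2 by auto
    then show ?thesis using CP[OF C] len_eq_1[of v] by (auto simp: gens_below_def)
  qed
  \<comment> \<open>A chain has at most one element of each length; at the end this identifies the
    rank-one element found in \<open>S\<close> with \<open>t\<close>.\<close>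
  have same: "x = y" if "?max C" "x \<in> C" "y \<in> C" "len x = len y" for C x y
    using tot[OF that(1-3)] below_eq_len CP[OF that(1)] that by metis
  have edge: "\<exists>x\<in>D. x \<in> S"
    if C: "?max C" and D: "?max D" and card1: "card (C - D) = 1" and sC: "\<exists>x\<in>C. x \<in> S" for C D
  proof -
    from sC obtain s where s: "s \<in> C" "s \<in> S" by blast
    show ?thesis
    proof (cases "s \<in> D")
      case False
      have sA: "s \<in> A" "s \<in> carrier G" using s S by (auto simp: gens_below_def A_carrier)
      obtain h where h: "h \<in> C" "s \<preceq> h" "len h = 2"
        using maxchain_has_cover[OF g C s(1)] len2 sA by auto
      have "C - D = {s}" using card1 s False by (metis DiffI card_1_singletonE singletonD)
      moreover have "h \<noteq> s" using h sA by auto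
      ultimately have hD: "h \<in> D" using h by blast
      obtain y where y: "y \<in> D" "y \<in> atoms g" using rank1[OF D] by blast
      have yA: "y \<in> A" "y \<in> carrier G" using y by (auto simp: gens_below_def A_carrier)
      have "y \<preceq> h" using tot[OF D y(1) hD] below_len yA h by fastforce
      then have "y \<in> atoms h" using yA by (simp add: gens_below_def)
      moreover have "h \<in> ranktwo g" using h CP[OF C h(1)] by (simp add: rank_two_below_def)
      ultimately show ?thesis using closed[OF s(2) _ h(2)] y by blast
    qed (use s in blast)
  qed
  have "t \<in> S" if t: "t \<in> atoms g" for t
  proof -
    obtain s where s: "s \<in> S" using S by blast
    have sA: "s \<in> A" "s \<preceq> g" "t \<in> A" "t \<preceq> g" using s S t by (auto simp: gens_below_def)
    obtain C where C: "?max C" "s \<in> C" using maxchain_through[OF g, of s] sA A_carrier by blast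
    obtain D where D: "?max D" "t \<in> D" using maxchain_through[OF g, of t] sA A_carrier by blast
    let ?H = "with_proj (mk_symmetric (chain_graph ?P below))"
    have "C \<rightarrow>\<^sup>*\<^bsub>?H\<^esub> D"
      using conn C D
      by (auto simp: chain_connected_def connected_def strongly_connected_def chain_graph_def)
    then have "(C, D) \<in> rtrancl_on (verts ?H) (arcs_ends ?H)" by (simp only: reachable_def)
    \<comment> \<open>Maximality is carried along in the induction because \<open>edge\<close> needs
      it at both ends of an arc.\<close>
    then have "(\<exists>x\<in>D. x \<in> S) \<and> ?max D"
    proof (induction rule: rtrancl_on_induct)
      case base
      then show ?case using C s by blast
    next
      case (step D E)
      from step.hyps have "?max E" "card (D - E) = 1"
        by (auto simp: parcs_mk_symmetric chain_graph_def)
      with step.IH edge[of D E] show ?case by blast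
    qed
    then obtain x where x: "x \<in> D" "x \<in> S" by blast
    then have "len x = len t" using S sA by (auto simp: gens_below_def)
    then show "t \<in> S" using same[OF D(1) x(1) D(2)] x by blast
  qed
  then show ?thesis using S by blast
qed

end

subsection \<open>Braid triangles and orders with a single ascent\<close>

text \<open>Some rotation of \<open>(p, q, r)\<close> is strictly decreasing; equivalently, the
  labels are distinct and going around the cycle meets exactly one ascent.\<close>

definition descending_cycle :: "nat \<Rightarrow> nat \<Rightarrow> nat \<Rightarrow> bool" where
  "descending_cycle p q r \<longleftrightarrow> (q < p \<and> r < q) \<or> (r < q \<and> p < r) \<or> (p < r \<and> q < p)"

context conj_gen_group
begin

text \<open>Equivalent to \<open>z = cj y x\<close> together with the braid relation
  \<open>x \<otimes> y \<otimes> x = y \<otimes> x \<otimes> y\<close>. In this form it is a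
  directed triangle whose three edges have the same label.\<close>

definition tri :: "'a \<Rightarrow> 'a \<Rightarrow> 'a \<Rightarrow> bool" where
  "tri x y z \<longleftrightarrow> x \<in> A \<and> y \<in> A \<and> z \<in> A \<and> x \<otimes> y = y \<otimes> z \<and> y \<otimes> z = z \<otimes> x"

lemma tri_rotate: "tri x y z \<Longrightarrow> tri y z x"
  by (simp add: tri_def)

lemma tri_cj: "u \<in> carrier G \<Longrightarrow> tri x y z \<Longrightarrow> tri (cj u x) (cj u y) (cj u z)"
  by (auto simp: tri_def A_carrier cj_in_A cj_mult[symmetric])

lemma cj_tri: "tri x y z \<Longrightarrow> cj y x = z"
  by (auto simp: tri_def A_carrier intro: cj_eqI)

lemma atomsD: "x \<in> atoms g \<Longrightarrow> x \<in> A" "x \<in> atoms g \<Longrightarrow> x \<in> carrier G" "x \<in> atoms g \<Longrightarrow> x \<preceq> g"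
  by (auto simp: gens_below_def A_carrier)

lemma ranktwoD: "h \<in> ranktwo g \<Longrightarrow> h \<in> carrier G" "h \<in> ranktwo g \<Longrightarrow> h \<preceq> g" "h \<in> ranktwo g \<Longrightarrow> len h = 2"
  by (auto simp: rank_two_below_def)

lemma atoms_of_product:
  assumes "x \<in> A" "y \<in> A" "len (x \<otimes> y) = 2"
  shows "x \<in> atoms (x \<otimes> y)" "y \<in> atoms (x \<otimes> y)"
  using assms by (auto simp: gens_below_def A_carrier below_mult_iff below_mult_suffix_iff)

lemma ranktwo_product_atoms:
  assumes "x \<in> A" "y \<in> A" "x \<otimes> y \<in> ranktwo g" "g \<in> carrier G"
  shows "x \<in> atoms g" "y \<in> atoms g"
  using atoms_of_product[OF assms(1,2)] atoms_mono(1)[of "x \<otimes> y" g] ranktwoD[OF assms(3)] assms(4)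
  by blast+

lemma ranktwo_factor:
  assumes "h \<in> ranktwo g" "x \<in> A" "x \<preceq> h"
  shows "inv x \<otimes> h \<in> A" "x \<otimes> (inv x \<otimes> h) = h"
proof -
  have h: "h \<in> carrier G" "len h = 2" using ranktwoD[OF assms(1)] by auto
  have "len (inv x \<otimes> h) = 1" using assms h by (simp add: prefix_le_def)
  then show "inv x \<otimes> h \<in> A" using assms h A_carrier by (auto intro: len_eq_1)
  show "x \<otimes> (inv x \<otimes> h) = h" using assms h A_carrier by (simp add: mult_inv_cancel)
qed

text \<open>Cancelling \<open>x\<close> reduces the search for rank-two elements above
  \<open>x\<close> to the atoms of the complement \<open>w\<close>.\<close>

lemma ranktwo_above_atom:
  assumes "x \<in> A" "w \<in> carrier G" "h \<in> ranktwo (x \<otimes> w)" "x \<preceq> h"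
  shows "\<exists>y\<in>atoms w. h = x \<otimes> y"
proof -
  let ?y = "inv x \<otimes> h"
  have y: "?y \<in> A" "x \<otimes> ?y = h" using ranktwo_factor[OF assms(3,1,4)] by auto
  have h: "h \<in> carrier G" "h \<preceq> x \<otimes> w" "len h = 2" using ranktwoD[OF assms(3)] by auto
  have x: "x \<in> carrier G" using assms A_carrier by blast
  have "x \<preceq> x \<otimes> w" using below_trans[OF assms(4) h(2)] x h assms by simp
  then have "?y \<preceq> w"
    by (rule below_mult_cancel[OF x assms(2) A_carrier[OF y(1)]]) (use y h assms in auto)
  then show ?thesis using y by (auto simp: gens_below_def)
qed

text \<open>The bounds sum to the length of the product, so all of them are attained. Then
  \<open>v\<close> is a prefix of a suffix, and suffixes are prefixes.\<close>

lemma middle_factor: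
  assumes "u \<in> carrier G" "v \<in> carrier G" "w \<in> carrier G"
    and "len u \<le> i" "len v \<le> j" "len w \<le> k" "len (u \<otimes> (v \<otimes> w)) = i + j + k"
  shows "v \<preceq> u \<otimes> (v \<otimes> w)" "len v = j"
proof -
  have "len (u \<otimes> (v \<otimes> w)) \<le> len u + len (v \<otimes> w)" "len (v \<otimes> w) \<le> len v + len w"
    using assms(1-3) by (blast intro: len_mult_le m_closed)+
  then have *: "len (u \<otimes> (v \<otimes> w)) = len u + len (v \<otimes> w)" "len (v \<otimes> w) = len v + len w" "len v = j"
    using assms(4-7) by auto
  then have "v \<preceq> v \<otimes> w" "v \<otimes> w \<preceq> u \<otimes> (v \<otimes> w)"
    using assms by (auto simp: below_mult_iff below_mult_suffix_iff)
  then show "v \<preceq> u \<otimes> (v \<otimes> w)" "len v = j" using below_trans assms * by auto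
qed

text \<open>As \<open>c\<close> is fixed by its own conjugation, \<open>cj c\<close> is an
  automorphism of the interval below \<open>c\<close>.\<close>

lemma cj_c_ranktwo:
  assumes "c \<in> carrier G" "h \<in> carrier G"
  shows "cj c h \<in> ranktwo c \<longleftrightarrow> h \<in> ranktwo c"
  using ranktwo_cj_iff[of c c h] assms by simp

lemma len_pow_le: "b \<in> A \<Longrightarrow> len (b [^] (k::nat)) \<le> k"
proof (induction k)
  case (Suc k)
  then show ?case using len_mult_le[of "b [^] k" b] by (simp add: A_carrier)
qed simp

text \<open>Two triangles glued along the diagonal between \<open>q\<close> and \<open>t\<close>,
  which they traverse in opposite directions. The boundary is the directed four-cycle
  \<open>p\<close>, \<open>q\<close>, \<open>s\<close>, \<open>t\<close>.\<close>

definition sq :: "'a \<Rightarrow> 'a \<Rightarrow> 'a \<Rightarrow> 'a \<Rightarrow> 'a \<Rightarrow> bool" where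
  "sq g p q s t \<longleftrightarrow> atoms g = {p, q, s, t} \<and> tri p q t \<and> tri q s t \<and>
     p \<otimes> q \<in> ranktwo g \<and> q \<otimes> s \<in> ranktwo g \<and> p \<noteq> q \<and> q \<noteq> s"

lemma sq_cj:
  assumes "sq g p q s t" "g \<in> carrier G" "u \<in> carrier G"
  shows "sq (cj u g) (cj u p) (cj u q) (cj u s) (cj u t)"
proof -
  have A: "p \<in> A" "q \<in> A" "s \<in> A" "t \<in> A" using assms by (auto simp: sq_def tri_def)
  then show ?thesis
    using assms ranktwo_cj_iff[of u g "p \<otimes> q"] ranktwo_cj_iff[of u g "q \<otimes> s"]
    by (auto simp: sq_def atoms_cj tri_cj cj_mult[symmetric] cj_inject A_carrier)
qed

end

text \<open>The order is replaced by a numbering \<open>f\<close> of the atoms, which turns order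
  arguments into linear arithmetic. Compatibility becomes \<open>unique_ascent\<close>, where a
  square counts as a weak ascent.\<close>

locale labelled = conj_gen_group +
  fixes c :: 'a and r :: "'a rel" and f :: "'a \<Rightarrow> nat"
  assumes c_carrier: "c \<in> carrier G"
    and finite_atoms: "finite (atoms c)"
    and label_le: "\<And>x y. x \<in> atoms c \<Longrightarrow> y \<in> atoms c \<Longrightarrow> (x, y) \<in> r \<longleftrightarrow> f x \<le> f y"
    and label_inj: "inj_on f (atoms c)"
    and unique_ascent: "\<And>h x y x' y'. h \<in> ranktwo c \<Longrightarrow> x \<in> A \<Longrightarrow> y \<in> A \<Longrightarrow> x' \<in> A \<Longrightarrow> y' \<in> A \<Longrightarrow>
      x \<otimes> y = h \<Longrightarrow> x' \<otimes> y' = h \<Longrightarrow> f x \<le> f y \<Longrightarrow> f x' \<le> f y' \<Longrightarrow> x = x'"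
begin

abbreviation induces :: "'a \<Rightarrow> bool" where
  "induces g \<equiv> induces_linear_order (reduced_cycle_graph G A (Restr r (atoms g)) g)"

text \<open>The three edges of the triangle are distinct factorizations of one element, so at most
  one of them ascends; and labels cannot descend all the way around.\<close>

lemma tri_descending:
  assumes "tri x y z" "x \<otimes> y \<in> ranktwo c" "x \<noteq> y"
  shows "descending_cycle (f x) (f y) (f z)"
proof -
  have A: "x \<in> A" "y \<in> A" "z \<in> A" and e: "x \<otimes> y = y \<otimes> z" "y \<otimes> z = z \<otimes> x"
    using assms by (auto simp: tri_def)
  have "z \<noteq> x" using e assms(3) A A_carrier by (metis right_cancel)
  moreover have "y \<noteq> z" using e assms(3) A A_carrier by (metis right_cancel)
  moreover have "y \<otimes> z = x \<otimes> y" "z \<otimes> x = x \<otimes> y" using e by auto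
  ultimately have "\<not> (f x \<le> f y \<and> f y \<le> f z)" "\<not> (f y \<le> f z \<and> f z \<le> f x)" "\<not> (f z \<le> f x \<and> f x \<le> f y)"
    using unique_ascent[OF assms(2)] A assms(3) by metis+
  then show ?thesis unfolding descending_cycle_def by linarith
qed

text \<open>
  With a single ascent, \<open>\<nu>\<close> maps every element but the smallest one to its predecessor.
\<close>

lemma induces_of_single_ascent:
  assumes g: "g \<in> carrier G" "g \<preceq> c"
    and bij: "bij_betw \<nu> (atoms g) (atoms g)"
    and edge: "\<And>u. u \<in> atoms g \<Longrightarrow> f (\<nu> u) < f u \<Longrightarrow> u \<otimes> \<nu> u \<in> ranktwo g"
    and single: "\<And>u w. u \<in> atoms g \<Longrightarrow> w \<in> atoms g \<Longrightarrow> f u \<le> f (\<nu> u) \<Longrightarrow> f w \<le> f (\<nu> w) \<Longrightarrow> u = w"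
  shows "induces g"
proof -
  let ?X = "atoms g"
  let ?D = "reduced_cycle_graph G A (Restr r ?X) g"
  have sub: "?X \<subseteq> atoms c" using atoms_mono g c_carrier by blast
  have fin: "finite ?X" using sub finite_atoms finite_subset by blast
  have inj: "u = v" if "u \<in> ?X" "v \<in> ?X" "f u = f v" for u v
    using that sub label_inj by (auto dest: inj_onD)
  have \<nu>X: "\<nu> u \<in> ?X" if "u \<in> ?X" for u using bij that by (auto simp: bij_betw_def)
  have verts: "verts ?D = ?X" by (simp add: reduced_cycle_graph_def cycle_graph_def)
  have arc_iff: "(u, v) \<in> arcs_ends ?D \<longleftrightarrow>
      u \<in> ?X \<and> v \<in> ?X \<and> u \<otimes> v \<in> ranktwo g \<and> f v < f u" for u v
  proof (cases "u \<in> ?X \<and> v \<in> ?X")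
    case True
    then have "(u, v) \<in> r \<longleftrightarrow> f u \<le> f v" using label_le sub by blast
    then show ?thesis
      by (auto simp: reduced_cycle_graph_def cycle_graph_def arcs_ends_def arc_to_ends_def image_iff)
  qed (auto simp: reduced_cycle_graph_def cycle_graph_def arcs_ends_def arc_to_ends_def)
  have mono: "u \<in> ?X \<and> v \<in> ?X \<and> f v \<le> f u" if "u \<rightarrow>\<^sup>*\<^bsub>?D\<^esub> v" for u v
    using that unfolding reachable_def
    by (induction rule: rtrancl_on_induct) (auto simp: verts arc_iff)
  have pred: "\<exists>w\<in>?X. \<nu> w = v \<and> f v < f w \<and> f w \<le> f u"
    if uv: "u \<in> ?X" "v \<in> ?X" "f v < f u" for u v
  proof -
    \<comment> \<open>No label is below that of \<open>m\<close>, so \<open>m\<close> carries the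
      single ascent and \<nu> descends everywhere else.\<close>
    define m where "m = arg_min f (\<lambda>w. w \<in> ?X)"
    have m: "m \<in> ?X" "\<And>w. w \<in> ?X \<Longrightarrow> f m \<le> f w"
      using arg_min_nat_lemma[of "\<lambda>w. w \<in> ?X" u f] uv by (auto simp: m_def)
    \<comment> \<open>Pigeonhole: \<nu> maps \<open>?U\<close> injectively into \<open>?L\<close>,
      and both have the same size, so \<open>v\<close> has a preimage in \<open>?U\<close>.\<close>
    let ?L = "{w \<in> ?X. f w < f u}" and ?U = "{w \<in> ?X. f w \<le> f u} - {m}"
    have desc: "f (\<nu> w) < f w" if "w \<in> ?X" "w \<noteq> m" for w
      using single[OF that(1) m(1)] m(2)[OF \<nu>X[OF m(1)]] that by (meson not_le)
    have "{w \<in> ?X. f w \<le> f u} = insert u ?L" using uv inj by (auto simp: le_less)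
    then have "card {w \<in> ?X. f w \<le> f u} = Suc (card ?L)" using fin by simp
    moreover have "m \<in> {w \<in> ?X. f w \<le> f u}" using m uv by auto
    ultimately have "card ?U = card ?L" using fin by simp
    moreover have "inj_on \<nu> ?U" using bij by (auto simp: bij_betw_def intro: inj_on_subset)
    ultimately have card: "card (\<nu> ` ?U) = card ?L" by (simp add: card_image)
    have "\<nu> ` ?U \<subseteq> ?L" using desc \<nu>X by fastforce
    then have "\<nu> ` ?U = ?L" using card fin by (intro card_subset_eq) auto
    then obtain w where "w \<in> ?U" "\<nu> w = v" using uv by (metis (mono_tags, lifting) imageE mem_Collect_eq)
    then show ?thesis using desc by blast
  qed
  have reach: "u \<rightarrow>\<^sup>*\<^bsub>?D\<^esub> v" if "u \<in> ?X" "v \<in> ?X" "f v \<le> f u" for u v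
    using that
  proof (induction "f u - f v" arbitrary: v rule: less_induct)
    case less
    show ?case
    proof (cases "u = v")
      case True
      then show ?thesis using less by (auto simp: verts reachable_def)
    next
      case False
      then have "f v < f u" using inj less by (metis le_neq_implies_less)
      then obtain w where w: "w \<in> ?X" "\<nu> w = v" "f v < f w" "f w \<le> f u"
        using pred less by blast
      have "u \<rightarrow>\<^sup>*\<^bsub>?D\<^esub> w" using less(1)[of w] w less by auto
      moreover have "(w, v) \<in> arcs_ends ?D" using edge[of w] w less by (auto simp: arc_iff)
      ultimately show ?thesis
        unfolding reachable_def using less verts by (metis rtrancl_on_into_rtrancl_on)
    qed
  qed
  have "{(u, v). u \<rightarrow>\<^sup>*\<^bsub>?D\<^esub> v} = {(u, v). u \<in> ?X \<and> v \<in> ?X \<and> f v \<le> f u}"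
    using mono reach by blast
  moreover have "linear_order_on ?X {(u, v). u \<in> ?X \<and> v \<in> ?X \<and> f v \<le> f u}"
    using inj by (auto simp: linear_order_on_def partial_order_on_def preorder_on_def refl_on_def
        trans_def antisym_def total_on_def)
  ultimately show ?thesis by (simp add: induces_linear_order_def verts)
qed

lemma induces_len_le_1:
  assumes g: "g \<in> carrier G" "g \<preceq> c" and "len g \<le> 1"
  shows "induces g"
proof -
  have eq: "x = g" if "x \<in> atoms g" for x
    using below_eq_len[of x g] below_len[of x g] atomsD[OF that] assms by simp
  then have "u = w" if "u \<in> atoms g" "w \<in> atoms g" for u w using that by blast
  then show ?thesis
    \<comment> \<open>The identity serves as \<nu>: it never descends, and with at most one atom it
      has at most one ascent.\<close>
    by (intro induces_of_single_ascent[OF g, of id]) (auto simp del: One_nat_def)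
qed

text \<open>Sending an atom to its cofactor in \<open>g\<close> permutes the atoms along edges
  labelled \<open>g\<close>, and \<open>unique_ascent\<close> is then the single-ascent
  condition.\<close>

lemma induces_len_2:
  assumes g: "g \<in> carrier G" "g \<preceq> c" and "len g = 2"
  shows "induces g"
proof (rule induces_of_single_ascent[OF g, of "\<lambda>u. inv u \<otimes> g"])
  have g2: "g \<in> ranktwo g" "g \<in> ranktwo c" using assms by (auto simp: rank_two_below_def)
  have fac: "inv u \<otimes> g \<in> A" "u \<otimes> (inv u \<otimes> g) = g" if "u \<in> atoms g" for u
    using ranktwo_factor[OF g2(1)] atomsD[OF that] by auto
  have inj: "inj_on (\<lambda>u. inv u \<otimes> g) (atoms g)"
    using g(1) atomsD(2) by (intro inj_onI) (metis inv_closed inv_inv right_cancel)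
  have into: "(\<lambda>u. inv u \<otimes> g) ` atoms g \<subseteq> atoms g"
  proof (rule image_subsetI)
    fix u assume u: "u \<in> atoms g"
    show "inv u \<otimes> g \<in> atoms g"
      using atoms_of_product(2)[OF atomsD(1)[OF u] fac(1)[OF u]] fac(2)[OF u] assms by simp
  qed
  have "finite (atoms g)" using atoms_mono(1)[of g c] g c_carrier finite_atoms finite_subset by blast
  then show "bij_betw (\<lambda>u. inv u \<otimes> g) (atoms g) (atoms g)"
    using inj into by (simp add: bij_betw_def endo_inj_surj)
  show "u \<otimes> (inv u \<otimes> g) \<in> ranktwo g" if "u \<in> atoms g" for u using fac[OF that] g2 by simp
  show "u = w" if "u \<in> atoms g" "w \<in> atoms g" "f u \<le> f (inv u \<otimes> g)" "f w \<le> f (inv w \<otimes> g)" for u w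
    using unique_ascent[OF g2(2)] fac that atomsD by metis
qed

text \<open>Each triangle has one ascent, and the diagonal, traversed once in each direction,
  accounts for exactly one of the two. One ascent is left on the boundary four-cycle.\<close>

lemma induces_sq:
  assumes g: "g \<in> carrier G" "g \<preceq> c" and sq: "sq g p q s t"
  shows "induces g"
proof -
  have at: "atoms g = {p, q, s, t}" and t: "tri p q t" "tri q s t"
    and R: "p \<otimes> q \<in> ranktwo g" "q \<otimes> s \<in> ranktwo g" and ne: "p \<noteq> q" "q \<noteq> s"
    using sq by (auto simp: sq_def)
  have Rc: "p \<otimes> q \<in> ranktwo c" "q \<otimes> s \<in> ranktwo c" using R atoms_mono g c_carrier by blast+
  have R': "s \<otimes> t \<in> ranktwo g" "t \<otimes> p \<in> ranktwo g" using R t by (auto simp: tri_def)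
  have d: "descending_cycle (f p) (f q) (f t)" "descending_cycle (f q) (f s) (f t)"
    using tri_descending t Rc ne by blast+
  have fd: "f p \<noteq> f q" "f p \<noteq> f s" "f p \<noteq> f t" "f q \<noteq> f s" "f q \<noteq> f t" "f s \<noteq> f t"
    using d unfolding descending_cycle_def by linarith+
  then have dist: "p \<noteq> q" "p \<noteq> s" "p \<noteq> t" "q \<noteq> s" "q \<noteq> t" "s \<noteq> t" by auto
  let ?\<nu> = "\<lambda>u. if u = p then q else if u = q then s else if u = s then t else p"
  show ?thesis
  proof (rule induces_of_single_ascent[OF g, of ?\<nu>])
    show "bij_betw ?\<nu> (atoms g) (atoms g)"
      using dist unfolding at bij_betw_def inj_on_def by auto
    show "u \<otimes> ?\<nu> u \<in> ranktwo g" if "u \<in> atoms g" for u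
      using that R R' dist unfolding at by auto
    show "u = w" if "u \<in> atoms g" "w \<in> atoms g" "f u \<le> f (?\<nu> u)" "f w \<le> f (?\<nu> w)" for u w
      using that d dist unfolding at descending_cycle_def by (auto split: if_splits)
  qed
qed

text \<open>On elements labelled above \<open>x\<close>, the map \<open>k\<close> lowers the label
  but stays above \<open>x\<close>; if there are none, it lowers every label in \<open>Y\<close>.
  Either way an element of least label gives a contradiction.\<close>

lemma no_infinite_cycle:
  assumes y: "y \<in> Y"
    and step: "\<And>y. y \<in> Y \<Longrightarrow> k y \<in> Y \<and> descending_cycle (f x) (f y) (f (k y))"
  shows False
proof (cases "\<exists>y\<in>Y. f x < f y")
  case True
  define m where "m = arg_min f (\<lambda>y. y \<in> Y \<and> f x < f y)"
  have m: "m \<in> Y" "f x < f m" "\<And>w. w \<in> Y \<Longrightarrow> f x < f w \<Longrightarrow> f m \<le> f w"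
    using True arg_min_nat_lemma[of "\<lambda>y. y \<in> Y \<and> f x < f y" _ f] by (auto simp: m_def)
  show ?thesis using step[OF m(1)] m(3)[of "k m"] m(2) by (auto simp: descending_cycle_def)
next
  case False
  define m where "m = arg_min f (\<lambda>y. y \<in> Y)"
  have m: "m \<in> Y" "\<And>w. w \<in> Y \<Longrightarrow> f m \<le> f w"
    using y arg_min_nat_lemma[of "\<lambda>y. y \<in> Y" _ f] by (auto simp: m_def)
  show ?thesis using step[OF m(1)] m(2)[of "k m"] False m(1) by (fastforce simp: descending_cycle_def)
qed

end

subsection \<open>Braid chains\<close>

text \<open>Here \<open>N\<close> is \<open>n - 1\<close>. The inclusion in \<open>atoms_pow\<close>
  also covers \<open>k = 0\<close>, where there are no atoms.\<close>

locale braid_chain = labelled G A c r f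
  for G :: "('a, 'm) monoid_scheme" (structure) and A c r f +
  fixes a b :: 'a and N :: nat
  assumes aA: "a \<in> A" and bA: "b \<in> A"
    and a_neq_b: "a \<noteq> b"
    and tri_ab: "tri a b (cj b a)"
    and atoms_ab: "atoms (a \<otimes> b) = {a, b, cj b a}"
    and c_eq: "c = a \<otimes> b [^] N"
    and len_c: "len c = Suc N"
    and N_ge_2: "2 \<le> N"
    and atoms_pow: "\<And>k. k \<le> N \<Longrightarrow> atoms (b [^] k) \<subseteq> {b}"
    and tcc: "totally_chain_connected (factorization_poset G A c) below"
begin

definition a1 where "a1 = cj b a"
definition a2 where "a2 = cj b a1"
definition a3 where "a3 = cj b a2"

lemma in_A [simp]: "a \<in> A" "b \<in> A" "a1 \<in> A" "a2 \<in> A" "a3 \<in> A"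
  by (simp_all add: aA bA a1_def a2_def a3_def cj_in_A A_carrier)

lemma in_carrier [simp]:
  "a \<in> carrier G" "b \<in> carrier G" "a1 \<in> carrier G" "a2 \<in> carrier G" "a3 \<in> carrier G"
  by (simp_all add: A_carrier)

text \<open>Conjugation by \<open>b\<close> fixes \<open>b\<close> and shifts the sequence
  \<open>a\<close>, \<open>a1\<close>, \<open>a2\<close>, \<open>a3\<close>, so it moves each
  triangle to the next.\<close>

lemma tris: "tri a b a1" "tri a1 b a2" "tri a2 b a3"
proof -
  show 0: "tri a b a1" using tri_ab by (simp add: a1_def)
  show 1: "tri a1 b a2" using tri_cj[OF _ 0, of b] by (simp add: a1_def[symmetric] a2_def[symmetric])
  show "tri a2 b a3" using tri_cj[OF _ 1, of b] by (simp add: a2_def[symmetric] a3_def[symmetric])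
qed

lemma tri_eqs:
  "a \<otimes> b = b \<otimes> a1" "b \<otimes> a1 = a1 \<otimes> a" "a1 \<otimes> b = b \<otimes> a2" "b \<otimes> a2 = a2 \<otimes> a1"
  "a2 \<otimes> b = b \<otimes> a3" "b \<otimes> a3 = a3 \<otimes> a2"
  using tris by (auto simp: tri_def)

lemma b_neq: "b \<noteq> a1" "b \<noteq> a2" "b \<noteq> a3"
proof -
  have "cj b b = b" by simp
  then show "b \<noteq> a1" using a_neq_b cj_inject[of b a b] by (auto simp: a1_def)
  then show "b \<noteq> a2" using cj_inject[of b a1 b] by (auto simp: a2_def)
  then show "b \<noteq> a3" using cj_inject[of b a2 b] by (auto simp: a3_def)
qed

lemma initial_segment:
  assumes "k \<le> N"
  shows "a \<otimes> b [^] k \<in> carrier G" "a \<otimes> b [^] k \<preceq> c" "len (a \<otimes> b [^] k) = Suc k"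
    and "chain_connected (factorization_poset G A (a \<otimes> b [^] k)) below"
proof -
  let ?g = "a \<otimes> b [^] k"
  show g: "?g \<in> carrier G" by simp
  have c: "c = \<one> \<otimes> (?g \<otimes> b [^] (N - k))"
    using assms by (simp add: c_eq m_assoc nat_pow_mult)
  have "len ?g \<le> Suc k" using len_mult_le[of a "b [^] k"] len_pow_le[OF bA, of k] by simp
  then show le: "?g \<preceq> c" and "len ?g = Suc k"
    using middle_factor[of \<one> ?g "b [^] (N - k)" 0 "Suc k" "N - k"] len_pow_le[OF bA, of "N - k"]
      len_c assms unfolding c by auto
  \<comment> \<open>The poset of \<open>?g\<close> is an interval of the whole poset, so it inherits
    connectivity from \<open>tcc\<close>.\<close>
  have "factorization_poset G A ?g = poset_interval (factorization_poset G A c) below \<one> ?g"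
    using below_trans[OF _ le _ g c_carrier] by (auto simp: factorization_poset_eq poset_interval_def)
  then show "chain_connected (factorization_poset G A ?g) below"
    using tcc g le c_carrier by (auto simp: totally_chain_connected_def factorization_poset_eq)
qed

section \<open>Elements of length three and the bound on \<open>N\<close>\<close>

abbreviation "g3 \<equiv> a \<otimes> (b \<otimes> b)"
abbreviation "g4 \<equiv> a \<otimes> (b \<otimes> (b \<otimes> b))"

lemma pow_eqs: "b [^] (2::nat) = b \<otimes> b" "b [^] (3::nat) = b \<otimes> (b \<otimes> b)"
    "b [^] (4::nat) = b \<otimes> (b \<otimes> (b \<otimes> b))"
  by (simp_all add: numeral_eq_Suc m_assoc)

lemma atoms_2:
  "atoms (a \<otimes> b) = {a, b, a1}" "atoms (b \<otimes> a1) = {a, b, a1}"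
  "atoms (b \<otimes> a2) = {a1, b, a2}" "atoms (b \<otimes> a3) = {a2, b, a3}"
  "atoms (b \<otimes> b) \<subseteq> {b}" "atoms (a1 \<otimes> a1) \<subseteq> {a1}"
proof -
  show 0: "atoms (a \<otimes> b) = {a, b, a1}" using atoms_ab by (simp add: a1_def)
  then show "atoms (b \<otimes> a1) = {a, b, a1}" by (simp add: tri_eqs(1))
  have "cj b (a \<otimes> b) = a1 \<otimes> b" by (simp add: cj_mult a1_def)
  then have 1: "atoms (a1 \<otimes> b) = {a1, b, a2}"
    using atoms_cj[of b "a \<otimes> b"] 0 by (simp add: a1_def[symmetric] a2_def[symmetric])
  then show "atoms (b \<otimes> a2) = {a1, b, a2}" by (simp add: tri_eqs(3))
  have "cj b (a1 \<otimes> b) = a2 \<otimes> b" by (simp add: cj_mult a2_def)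
  then have "atoms (a2 \<otimes> b) = {a2, b, a3}"
    using atoms_cj[of b "a1 \<otimes> b"] 1 by (simp add: a2_def[symmetric] a3_def[symmetric])
  then show "atoms (b \<otimes> a3) = {a2, b, a3}" by (simp add: tri_eqs(5))
  show bb: "atoms (b \<otimes> b) \<subseteq> {b}" using atoms_pow[of 2] N_ge_2 by (simp add: pow_eqs)
  \<comment> \<open>Conjugating by \<open>a1\<close> and then by \<open>b\<close> carries
    \<open>b\<close> to \<open>a\<close> and then to \<open>a1\<close>; this transfers the claim on
    the square of \<open>b\<close> to the square of \<open>a1\<close>.\<close>
  have "cj a1 b = a" using cj_tri[OF tri_rotate[OF tris(1)]] .
  then have "a1 = cj b (cj a1 b)" by (simp add: a1_def)
  then have a1: "a1 = cj (a1 \<otimes> b) b" by (simp add: cj_cj)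
  have "a1 \<otimes> a1 = cj (a1 \<otimes> b) (b \<otimes> b)" using a1 by (simp add: cj_mult)
  then have "atoms (a1 \<otimes> a1) = cj (a1 \<otimes> b) ` atoms (b \<otimes> b)" using atoms_cj[of "a1 \<otimes> b" "b \<otimes> b"] by simp
  then show "atoms (a1 \<otimes> a1) \<subseteq> {a1}" using bb a1 by auto
qed

text \<open>The braid relations bring each further atom to the front, exposing a complement with
  known atoms.\<close>

lemma g3_eqs: "g3 = b \<otimes> (a1 \<otimes> b)" "g3 = a1 \<otimes> (a \<otimes> b)" "g3 = a2 \<otimes> (a1 \<otimes> a1)"
proof -
  show 1: "g3 = b \<otimes> (a1 \<otimes> b)" by (simp add: m_assoc[symmetric] tri_eqs(1))
  have "b \<otimes> (a1 \<otimes> b) = a1 \<otimes> (a \<otimes> b)" by (simp add: m_assoc[symmetric]) (simp add: tri_eqs(2))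
  with 1 show "g3 = a1 \<otimes> (a \<otimes> b)" by simp
  have "a1 \<otimes> b = a2 \<otimes> a1" by (simp add: tri_eqs(3,4))
  then have "b \<otimes> (a1 \<otimes> b) = b \<otimes> a2 \<otimes> a1" by (simp only: m_assoc in_carrier)
  also have "\<dots> = a2 \<otimes> (a1 \<otimes> a1)" unfolding tri_eqs(4) by (simp add: m_assoc)
  finally show "g3 = a2 \<otimes> (a1 \<otimes> a1)" using 1 by simp
qed

lemma g3_facts: "g3 \<preceq> c" "len g3 = 3" "chain_connected (factorization_poset G A g3) below"
  using initial_segment[of 2] N_ge_2 by (simp_all add: pow_eqs)

lemma len_product_le: "x \<in> A \<Longrightarrow> y \<in> A \<Longrightarrow> len (x \<otimes> y) \<le> 2"
  using len_mult_le[of x y] by (simp add: A_carrier)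

text \<open>For each of the four atoms the complement lists the rank-two elements above it, and none
  of these has an atom outside the set.\<close>

lemma atoms_g3: "atoms g3 = {a, b, a1, a2}"
proof (rule atoms_eq_of_closed)
  have pre: "x \<in> atoms g3" if "g3 = x \<otimes> (y \<otimes> z)" "x \<in> A" "y \<in> A" "z \<in> A" for x y z
    using prefix_atom[of x "y \<otimes> z" 2] that len_product_le[of y z] g3_facts by (simp add: A_carrier)
  show "{a, b, a1, a2} \<subseteq> atoms g3"
    using pre[of a b b] pre[OF g3_eqs(1)] pre[OF g3_eqs(2)] pre[OF g3_eqs(3)] by simp
  fix s h assume s: "s \<in> {a, b, a1, a2}" and h: "h \<in> ranktwo g3" "s \<preceq> h"
  have above: "\<exists>y\<in>atoms w. h = s \<otimes> y" if "g3 = s \<otimes> w" "w \<in> carrier G" for w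
    using ranktwo_above_atom[of s w h] s h that by auto
  have at1: "atoms (a1 \<otimes> b) = {a1, b, a2}" "atoms (a2 \<otimes> a1) = {a1, b, a2}" "atoms (a1 \<otimes> a) = {a, b, a1}"
    using atoms_2 by (simp_all add: tri_eqs)
  consider "s = a" | "s = b" | "s = a1" | "s = a2" using s by blast
  then show "atoms h \<subseteq> {a, b, a1, a2}"
  proof cases
    case 1
    then have "h = a \<otimes> b" using above[of "b \<otimes> b"] atoms_2(5) by auto
    then show ?thesis using atoms_2 by auto
  next
    case 2
    then have "h = b \<otimes> a1 \<or> h = b \<otimes> b \<or> h = b \<otimes> a2" using above[of "a1 \<otimes> b"] g3_eqs(1) at1 by auto
    then show ?thesis using atoms_2 by auto
  next
    case 3
    then have "h = a1 \<otimes> a \<or> h = a1 \<otimes> b \<or> h = a1 \<otimes> a1" using above[of "a \<otimes> b"] g3_eqs(2) atoms_2(1) by auto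
    then show ?thesis using atoms_2 at1 by auto
  next
    case 4
    then have "h = a2 \<otimes> a1" using above[of "a1 \<otimes> a1"] g3_eqs(3) atoms_2(6) by auto
    then show ?thesis using at1 by auto
  qed
qed (use g3_facts in auto)

lemma g3_sq: "sq g3 a b a2 a1"
proof -
  have "a \<otimes> b \<preceq> g3" "len (a \<otimes> b) = 2"
    using middle_factor[of \<one> "a \<otimes> b" b 0 2 1] g3_facts len_product_le[of a b] by (simp_all add: m_assoc)
  moreover have "b \<otimes> a2 \<preceq> g3" "len (b \<otimes> a2) = 2"
    using middle_factor[of b "b \<otimes> a2" \<one> 1 2 0] g3_facts len_product_le[of b a2] g3_eqs(1)
    by (simp_all add: tri_eqs)
  ultimately show ?thesis
    using atoms_g3 a_neq_b b_neq tris(1) tri_rotate[OF tris(2)] tris(2)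
    by (auto simp: sq_def rank_two_below_def)
qed

lemma no_long_chain: "N \<le> 3"
proof (rule ccontr)
  assume "\<not> N \<le> 3"
  then have N: "4 \<le> N" by simp
  define g where "g = a \<otimes> (b \<otimes> (b \<otimes> (b \<otimes> b)))"
  have g: "g \<in> carrier G" "g \<preceq> c" "len g = 5"
    using initial_segment[OF N] by (simp_all add: g_def pow_eqs)
  let ?k = "cj g"
  have k: "?k y = cj b (cj b (cj b (cj b (cj a y))))" if "y \<in> carrier G" for y
    using that by (simp add: g_def cj_cj m_assoc)
  have cja: "cj a a1 = b" using cj_tri[OF tri_rotate[OF tri_rotate[OF tris(1)]]] .
  have k1: "?k a1 = b" by (simp add: k cja)
  have "cj a1 b = a" using cj_tri[OF tri_rotate[OF tris(1)]] .
  \<comment> \<open>The automorphism \<open>?k\<close> turns \<open>a = cj a1 b\<close> into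
    \<open>?k a = cj b (?k b)\<close>. Comparison with the directly computed \<open>cj b a3\<close>
    gives the image of \<open>b\<close>.\<close>
  then have "?k a = cj (?k a1) (?k b)" using cj_of_cj[of g a1 b] g by simp
  also have "?k a = cj b a3" by (simp add: k a1_def[symmetric] a2_def[symmetric] a3_def[symmetric])
  finally have kb: "?k b = a3" using cj_inject[of b a3 "?k b"] g by (simp add: k1)
  have "?k a2 = cj a3 b" using cj_of_cj[of g b a1] g by (simp add: a2_def[symmetric] k1 kb)
  moreover have "cj a3 b = a2" using cj_tri[OF tri_rotate[OF tris(3)]] .
  ultimately have ka2: "?k a2 = a2" by simp
  \<comment> \<open>Moving two copies of \<open>b\<close> to the front exposes
    \<open>a2 \<otimes> b\<close> as a middle factor of \<open>g\<close>.\<close>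
  have R: "a2 \<otimes> b \<in> ranktwo g"
  proof -
    have "g = b \<otimes> a1 \<otimes> (b \<otimes> (b \<otimes> b))" by (simp add: g_def tri_eqs(1)[symmetric] m_assoc)
    also have "\<dots> = b \<otimes> (a1 \<otimes> b) \<otimes> (b \<otimes> b)" by (simp add: m_assoc)
    also have "\<dots> = (b \<otimes> b) \<otimes> ((a2 \<otimes> b) \<otimes> b)" by (simp add: tri_eqs(3) m_assoc)
    finally have "g = (b \<otimes> b) \<otimes> ((a2 \<otimes> b) \<otimes> b)" .
    then show ?thesis
      using middle_factor[of "b \<otimes> b" "a2 \<otimes> b" b 2 2 1] g len_product_le[of b b] len_product_le[of a2 b]
      by (simp add: rank_two_below_def)
  qed
  \<comment> \<open>All conditions are invariant under \<open>?k\<close>, which fixes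
    \<open>g\<close> and \<open>a2\<close>; each step from \<open>y\<close> to \<open>?k y\<close>
    is a triangle with apex \<open>a2\<close>.\<close>
  let ?Y = "{y \<in> A. y \<noteq> a2 \<and> a2 \<otimes> y \<in> ranktwo g \<and> tri a2 y (?k y)}"
  have "b \<in> ?Y" using R tris(3) b_neq by (simp add: kb)
  moreover have "?k y \<in> ?Y \<and> descending_cycle (f a2) (f y) (f (?k y))" if y: "y \<in> ?Y" for y
  proof -
    have yc: "y \<in> carrier G" using y A_carrier by blast
    have "?k (a2 \<otimes> y) \<in> ranktwo g" using y g yc by (simp add: cj_c_ranktwo)
    then have "a2 \<otimes> ?k y \<in> ranktwo g" using g yc by (simp add: cj_mult ka2)
    moreover have "tri a2 (?k y) (?k (?k y))" using tri_cj[of g a2 y "?k y"] y g by (simp add: ka2)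
    moreover have "?k y \<noteq> a2" using y yc g cj_inject[of g y a2] by (simp add: ka2)
    moreover have "?k y \<in> A" using y g by (simp add: cj_in_A)
    moreover have "a2 \<otimes> y \<in> ranktwo c" using y atoms_mono(2)[OF g(2) g(1) c_carrier] by blast
    then have "descending_cycle (f a2) (f y) (f (?k y))" using tri_descending[of a2 y "?k y"] y by blast
    ultimately show ?thesis by blast
  qed
  ultimately show False by (rule no_infinite_cycle)
qed

lemma induces_rank_three_total:
  assumes "N = 2" "g \<in> factorization_poset G A c"
  shows "induces g"
proof -
  have g: "g \<in> carrier G" "g \<preceq> c" using assms(2) by (auto simp: factorization_poset_eq)
  have c: "c = g3" using c_eq assms by (simp add: pow_eqs)
  consider "len g \<le> 1" | "len g = 2" | "len g = 3" using below_len[OF g(2)] len_c assms(1) by linarith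
  then show ?thesis
  proof cases
    case 3
    then have "g = c" using below_eq_len[OF g(2,1) c_carrier] len_c assms(1) by simp
    then show ?thesis using induces_sq[OF g] g3_sq c by blast
  qed (use induces_len_le_1 induces_len_2 g in blast)+
qed

end

section \<open>The case of length four\<close>

locale braid_chain_four = braid_chain +
  assumes N_eq: "N = 3"
begin

text \<open>The missing atom: \<open>cj c\<close> permutes the atoms in the orbits \<open>a\<close>,
  \<open>a3\<close>, \<open>e\<close> and \<open>b\<close>, \<open>a2\<close>,
  \<open>a1\<close>.\<close>

definition e where "e = cj c a3"

lemma c_eq_g4: "c = g4"
  using c_eq N_eq by (simp add: pow_eqs)

lemma len_c_eq: "len c = 4"
  using len_c N_eq by simp

lemma e_in [simp]: "e \<in> A" "e \<in> carrier G"
  by (simp_all add: e_def cj_in_A c_carrier A_carrier)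

lemma cj_c_simps [simp]:
  "cj c a = a3" "cj c a3 = e" "cj c e = a" "cj c b = a2" "cj c a2 = a1" "cj c a1 = b"
proof -
  note cc = c_carrier
  have k: "cj c y = cj b (cj b (cj b (cj a y)))" if "y \<in> carrier G" for y
    using that by (simp add: c_eq_g4 cj_cj m_assoc)
  have "cj a a1 = b" using cj_tri[OF tri_rotate[OF tri_rotate[OF tris(1)]]] .
  then show k1: "cj c a1 = b" by (simp add: k)
  show ka: "cj c a = a3" by (simp add: k a1_def[symmetric] a2_def[symmetric] a3_def[symmetric])
  have "cj a1 b = a" using cj_tri[OF tri_rotate[OF tris(1)]] .
  then have "cj b a2 = cj b (cj c b)" using cj_of_cj[of c a1 b] cc by (simp add: ka k1 a3_def)
  then show kb: "cj c b = a2" using cj_inject[of b a2 "cj c b"] cc by simp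
  have "cj a2 b = a1" using cj_tri[OF tri_rotate[OF tris(2)]] .
  then show k2: "cj c a2 = a1" using cj_of_cj[of c b a1] cc by (simp add: a2_def[symmetric] k1 kb)
  show k3: "cj c a3 = e" by (simp add: e_def)
  \<comment> \<open>Two applications of \<open>cj c\<close> to the triangle \<open>a2\<close>,
    \<open>b\<close>, \<open>a3\<close> end in a triangle on \<open>b\<close>, \<open>a1\<close>,
    whose third corner \<open>cj a1 b = a\<close> is known.\<close>
  have "tri a1 a2 e" using tri_cj[OF cc tris(3)] by (simp add: k2 kb k3)
  then have "tri b a1 (cj c e)" using tri_cj[OF cc] k1 k2 by metis
  then have "cj c e = cj a1 b" using cj_tri by metis
  then show "cj c e = a" using \<open>cj a1 b = a\<close> by simp
qed

lemma tri_e: "tri a1 a2 e"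
  using tri_cj[OF c_carrier tris(3)] by simp

text \<open>Starting with \<open>b\<close> instead of \<open>a\<close> leaves a conjugate of
  \<open>g3\<close>, whose atoms and triangles are known.\<close>

lemma g4_eq: "c = b \<otimes> cj b g3"
proof -
  have "cj b g3 = a1 \<otimes> (b \<otimes> b)" by (simp add: cj_mult a1_def)
  moreover have "a \<otimes> b \<otimes> (b \<otimes> b) = b \<otimes> a1 \<otimes> (b \<otimes> b)" by (simp only: tri_eqs(1))
  ultimately show ?thesis by (simp add: c_eq_g4 m_assoc)
qed

lemma sq_b: "sq (cj b g3) a1 b a3 a2"
  using sq_cj[OF g3_sq, of b] by (simp add: a1_def[symmetric] a2_def[symmetric] a3_def[symmetric])

lemma atoms_pow_3: "atoms (b \<otimes> (b \<otimes> b)) \<subseteq> {b}"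
  using atoms_pow[of 3] N_eq by (simp add: pow_eqs)

lemma len_triple_le: "len (b \<otimes> (b \<otimes> b)) \<le> 3"
  using len_pow_le[OF bA, of 3] by (simp add: pow_eqs)

text \<open>Closedness is preserved by \<open>cj c\<close>, so it suffices to check \<open>a\<close>
  and \<open>b\<close>, one atom from each orbit.\<close>

lemma atoms_c: "atoms c = {a, b, a1, a2, a3, e}"
proof (rule atoms_eq_of_closed)
  let ?S = "{a, b, a1, a2, a3, e}"
  note cc = c_carrier
  show "chain_connected (factorization_poset G A c) below"
    using initial_segment(4)[of N] c_eq by simp
  have image: "cj c y \<in> atoms c" if "y \<in> atoms c" for y
    using atoms_cj[OF cc cc] that cc by auto
  have a: "a \<in> atoms c"
    using prefix_atom[of a "b \<otimes> (b \<otimes> b)" 3] len_triple_le len_c_eq by (simp add: c_eq_g4)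
  have b: "b \<in> atoms c"
    using prefix_atom[of b "cj b g3" 3] g3_facts len_c_eq by (simp add: g4_eq[symmetric])
  show "?S \<subseteq> atoms c"
    using a b image[OF a] image[OF image[OF a]] image[OF b] image[OF image[OF b]] by simp
  define closed where "closed s \<longleftrightarrow> (\<forall>h \<in> ranktwo c. s \<preceq> h \<longrightarrow> atoms h \<subseteq> ?S)" for s
  have S_image: "cj c ` ?S \<subseteq> ?S" by simp
  have closed_image: "closed (cj c s)" if s: "closed s" "s \<in> carrier G" for s
    unfolding closed_def
  proof (intro ballI impI)
    fix h assume h: "h \<in> ranktwo c" "cj c s \<preceq> h"
    have hc: "h \<in> carrier G" using h ranktwoD by blast
    define h' where "h' = cj (inv c) h"
    have h': "h' \<in> carrier G" "cj c h' = h" using hc cc by (simp_all add: h'_def)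
    have "h' \<in> ranktwo c" using cj_c_ranktwo[OF cc h'(1)] h h' by simp
    moreover have "s \<preceq> h'" using below_cj_iff[OF cc s(2) h'(1)] h h' by simp
    ultimately have "atoms h' \<subseteq> ?S" using s by (auto simp: closed_def)
    then have "cj c ` atoms h' \<subseteq> ?S" using S_image by blast
    then show "atoms h \<subseteq> ?S" using atoms_cj[OF cc h'(1)] h' by simp
  qed
  have "closed a"
    unfolding closed_def
  proof (intro ballI impI)
    fix h assume "h \<in> ranktwo c" "a \<preceq> h"
    then have "h = a \<otimes> b"
      using ranktwo_above_atom[of a "b \<otimes> (b \<otimes> b)" h] atoms_pow_3 by (auto simp: c_eq_g4)
    then show "atoms h \<subseteq> ?S" using atoms_2 by auto
  qed
  moreover have "closed b"
    unfolding closed_def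
  proof (intro ballI impI)
    fix h assume "h \<in> ranktwo c" "b \<preceq> h"
    then have "\<exists>y\<in>atoms (cj b g3). h = b \<otimes> y"
      using ranktwo_above_atom[of b "cj b g3" h] by (simp add: g4_eq[symmetric])
    moreover have "atoms (cj b g3) = {a1, b, a3, a2}" using sq_b by (simp add: sq_def)
    ultimately have "h = b \<otimes> a1 \<or> h = b \<otimes> b \<or> h = b \<otimes> a3 \<or> h = b \<otimes> a2" by auto
    then show "atoms h \<subseteq> ?S" using atoms_2 by auto
  qed
  ultimately have "closed a" "closed a3" "closed e" "closed b" "closed a2" "closed a1"
    using closed_image[of a] closed_image[of a3] closed_image[of b] closed_image[of a2] by simp_all
  then show "atoms h \<subseteq> ?S" if "s \<in> ?S" "h \<in> ranktwo c" "s \<preceq> h" for s h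
    using that by (auto simp: closed_def)
qed (use c_carrier len_c_eq in auto)

text \<open>The triangle \<open>b\<close>, \<open>a2\<close>, \<open>a1\<close> is surrounded by
  three others, each sharing one side with it in the opposite direction. Four ascents minus three
  for the shared sides leave one on the boundary six-cycle.\<close>

lemma induces_c: "induces c"
proof -
  have bg: "cj b g3 \<preceq> c" using below_mult_suffix_iff[of b "cj b g3"] g3_facts len_c_eq
    by (simp add: g4_eq[symmetric])
  have R1: "b \<otimes> a3 \<in> ranktwo c" "a1 \<otimes> b \<in> ranktwo c"
    using sq_b atoms_mono(2)[OF bg _ c_carrier] by (auto simp: sq_def)
  have R2: "a \<otimes> b \<in> ranktwo c" "b \<otimes> a2 \<in> ranktwo c"
    using g3_sq atoms_mono(2)[OF g3_facts(1) _ c_carrier] by (auto simp: sq_def)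
  \<comment> \<open>This is the image under \<open>cj c\<close> of the known rank-two element
    \<open>a2 \<otimes> b\<close>.\<close>
  have R3: "a1 \<otimes> a2 \<in> ranktwo c"
  proof -
    have "cj c (a2 \<otimes> b) \<in> ranktwo c"
      using R1(1) tri_eqs(5) cj_c_ranktwo[of c "a2 \<otimes> b"] c_carrier by simp
    then show ?thesis using c_carrier by (simp add: cj_mult)
  qed
  have R: "b \<otimes> a3 \<in> ranktwo c" "a3 \<otimes> a2 \<in> ranktwo c" "a2 \<otimes> e \<in> ranktwo c" "e \<otimes> a1 \<in> ranktwo c"
    "a1 \<otimes> a \<in> ranktwo c" "a \<otimes> b \<in> ranktwo c"
    using R1 R2 R3 tri_e tri_eqs by (auto simp: tri_def)
  have a12: "a1 \<noteq> a2" using cj_inject[of c a1 a2] b_neq c_carrier by auto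
  have d: "descending_cycle (f a) (f b) (f a1)" "descending_cycle (f b) (f a2) (f a1)"
    "descending_cycle (f b) (f a3) (f a2)" "descending_cycle (f a1) (f a2) (f e)"
    using tri_descending tris(1) tri_rotate[OF tris(2)] tri_rotate[OF tris(3)] tri_e
      R1 R2 R3 a_neq_b b_neq a12 by blast+
  have fd: "f a \<noteq> f b" "f a \<noteq> f a1" "f a \<noteq> f a2" "f a \<noteq> f a3" "f a \<noteq> f e"
    "f b \<noteq> f a1" "f b \<noteq> f a2" "f b \<noteq> f a3" "f b \<noteq> f e"
    "f a1 \<noteq> f a2" "f a1 \<noteq> f a3" "f a1 \<noteq> f e" "f a2 \<noteq> f a3" "f a2 \<noteq> f e" "f a3 \<noteq> f e"
    using d unfolding descending_cycle_def by linarith+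
  then have dist: "a \<noteq> b" "a \<noteq> a1" "a \<noteq> a2" "a \<noteq> a3" "a \<noteq> e" "b \<noteq> a1" "b \<noteq> a2" "b \<noteq> a3" "b \<noteq> e"
    "a1 \<noteq> a2" "a1 \<noteq> a3" "a1 \<noteq> e" "a2 \<noteq> a3" "a2 \<noteq> e" "a3 \<noteq> e" by auto
  define \<nu> where "\<nu> u = (if u = a then b else if u = b then a3 else if u = a3 then a2
    else if u = a2 then e else if u = e then a1 else a)" for u
  have \<nu>: "\<nu> a = b" "\<nu> b = a3" "\<nu> a3 = a2" "\<nu> a2 = e" "\<nu> e = a1" "\<nu> a1 = a"
    using dist by (auto simp: \<nu>_def)
  show ?thesis
  proof (rule induces_of_single_ascent[of c \<nu>])
    show "bij_betw \<nu> (atoms c) (atoms c)"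
      using dist unfolding atoms_c bij_betw_def inj_on_def by (auto simp: \<nu>)
    show "u \<otimes> \<nu> u \<in> ranktwo c" if "u \<in> atoms c" for u
      using that R unfolding atoms_c by (auto simp: \<nu>)
    have one: "f a \<le> f b \<longrightarrow> \<not> f b \<le> f a3 \<and> \<not> f a3 \<le> f a2 \<and> \<not> f a2 \<le> f e \<and> \<not> f e \<le> f a1 \<and> \<not> f a1 \<le> f a"
      "f b \<le> f a3 \<longrightarrow> \<not> f a3 \<le> f a2 \<and> \<not> f a2 \<le> f e \<and> \<not> f e \<le> f a1 \<and> \<not> f a1 \<le> f a"
      "f a3 \<le> f a2 \<longrightarrow> \<not> f a2 \<le> f e \<and> \<not> f e \<le> f a1 \<and> \<not> f a1 \<le> f a"
      "f a2 \<le> f e \<longrightarrow> \<not> f e \<le> f a1 \<and> \<not> f a1 \<le> f a"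
      "f e \<le> f a1 \<longrightarrow> \<not> f a1 \<le> f a"
      using d unfolding descending_cycle_def by linarith+
    show "u = w" if "u \<in> atoms c" "w \<in> atoms c" "f u \<le> f (\<nu> u)" "f w \<le> f (\<nu> w)" for u w
    proof -
      have "u = a \<or> u = b \<or> u = a3 \<or> u = a2 \<or> u = e \<or> u = a1"
        "w = a \<or> w = b \<or> w = a3 \<or> w = a2 \<or> w = e \<or> w = a1"
        using that unfolding atoms_c by auto
      then show ?thesis using that(3,4) one by (elim disjE) (simp_all add: \<nu>)
    qed
  qed (use c_carrier in auto)
qed

lemma induces_rank_three:
  assumes g: "g \<in> carrier G" "g \<preceq> c" and "len g = 3"
  shows "induces g"
proof -
  note cc = c_carrier
  \<comment> \<open>The left cofactor of \<open>g\<close> in \<open>c\<close> is an atom, so the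
    elements of length three are the complements of the six atoms.\<close>
  define y where "y = c \<otimes> inv g"
  have yc: "y \<in> carrier G" "c = y \<otimes> g" using g cc by (simp_all add: y_def m_assoc)
  have "inv g \<otimes> c = cj g y" using g cc by (simp add: y_def cj_def m_assoc)
  moreover have "len (inv g \<otimes> c) = 1" using g assms(3) len_c_eq by (simp add: prefix_le_def)
  ultimately have "len y = 1" using yc g by simp
  then have "y \<in> A" using yc len_eq_1 by blast
  moreover have "y \<preceq> c" using yc below_mult_iff[of y g] g assms(3) len_c_eq \<open>len y = 1\<close> by simp
  ultimately have y: "y \<in> {a, b, a1, a2, a3, e}" using atoms_c by (auto simp: gens_below_def)
  \<comment> \<open>Invariant under \<open>cj c\<close>, and checked for one atom of each orbit:
    \<open>a\<close> leaves the cube of \<open>b\<close>, and \<open>b\<close> leaves a square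
    configuration. Cancellation later identifies \<open>w\<close> with \<open>g\<close>.\<close>
  define good where "good z \<longleftrightarrow> (\<exists>w \<in> carrier G. c = z \<otimes> w \<and>
      ((\<exists>p q s t. sq w p q s t) \<or> (\<exists>d. atoms w \<subseteq> {d})))" for z
  have image: "good (cj c z)" if z: "good z" "z \<in> carrier G" for z
  proof -
    from z(1) obtain w where w: "w \<in> carrier G" "c = z \<otimes> w"
      "(\<exists>p q s t. sq w p q s t) \<or> (\<exists>d. atoms w \<subseteq> {d})"
      unfolding good_def by blast
    have "c = cj c c" using cc by simp
    also have "\<dots> = cj c z \<otimes> cj c w" using w(1,2) z(2) cc cj_mult by metis
    finally have "c = cj c z \<otimes> cj c w" .
    moreover have "(\<exists>p q s t. sq (cj c w) p q s t) \<or> (\<exists>d. atoms (cj c w) \<subseteq> {d})"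
      using w(3) sq_cj[OF _ w(1) cc] atoms_cj[OF cc w(1)] by (metis image_empty image_insert image_mono)
    moreover have "cj c w \<in> carrier G" using w(1) cc by simp
    ultimately show ?thesis unfolding good_def by blast
  qed
  have "good a" using c_eq_g4 atoms_pow_3 by (auto simp: good_def)
  moreover have "good b" using g4_eq sq_b by (auto simp: good_def)
  ultimately have "good a" "good a3" "good e" "good b" "good a2" "good a1"
    using image[of a] image[of a3] image[of b] image[of a2] by simp_all
  then have "good y" using y by auto
  then have "(\<exists>p q s t. sq g p q s t) \<or> (\<exists>d. atoms g \<subseteq> {d})"
    using yc g by (auto simp: good_def)
  then show ?thesis
  proof (elim disjE exE)
    fix d assume "atoms g \<subseteq> {d}"
    then have "u = w" if "u \<in> atoms g" "w \<in> atoms g" for u w using that by blast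
    then show ?thesis by (intro induces_of_single_ascent[OF g, of id]) auto
  qed (rule induces_sq[OF g])
qed

lemma induces_rank_four_total:
  assumes "g \<in> factorization_poset G A c"
  shows "induces g"
proof -
  have g: "g \<in> carrier G" "g \<preceq> c" using assms by (auto simp: factorization_poset_eq)
  consider "len g \<le> 1" | "len g = 2" | "len g = 3" | "len g = 4"
    using below_len[OF g(2)] len_c_eq by linarith
  then show ?thesis
  proof cases
    case 4
    then have "g = c" using below_eq_len[OF g(2,1) c_carrier] len_c_eq by simp
    then show ?thesis using induces_c by simp
  qed (use induces_len_le_1 induces_len_2 induces_rank_three g in blast)+
qed

end

lemma (in braid_chain) induces_all:
  assumes "g \<in> factorization_poset G A c"
  shows "induces g"
proof (cases "N = 2")
  case False
  then have "N = 3" using no_long_chain N_ge_2 by simp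
  then interpret braid_chain_four G A c r f a b N by unfold_locales
  show ?thesis using induces_rank_four_total[OF assms] .
qed (use induces_rank_three_total assms in blast)

subsection \<open>From the unique cover to a braid chain\<close>

context labelled
begin

text \<open>
  The third atom \<open>w\<close> of \<open>x \<otimes> y\<close> would satisfy \<open>w \<otimes> w = x \<otimes> y\<close>, giving a second ascent.
\<close>

lemma commuting_pair_atoms:
  assumes xy: "x \<in> A" "y \<in> A" "x \<noteq> y" "x \<otimes> y = y \<otimes> x" "x \<otimes> y \<in> ranktwo c"
  shows "card (atoms (x \<otimes> y)) \<noteq> 3"
proof
  assume card: "card (atoms (x \<otimes> y)) = 3"
  let ?h = "x \<otimes> y"
  have c: "x \<in> carrier G" "y \<in> carrier G" using xy A_carrier by auto
  have h2: "len ?h = 2" "?h \<in> ranktwo ?h" using ranktwoD[OF xy(5)] by (auto simp: rank_two_below_def)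
  have fin: "finite (atoms ?h)" using card card.infinite by force
  have xyin: "x \<in> atoms ?h" "y \<in> atoms ?h" using atoms_of_product xy h2 by auto
  then have "card (atoms ?h - {x, y}) = 1" using card xy(3) fin by (simp add: card_Diff_subset)
  then obtain w where w: "atoms ?h - {x, y} = {w}" by (rule card_1_singletonE)
  then have wa: "w \<in> atoms ?h" "w \<noteq> x" "w \<noteq> y" by auto
  then have wA: "w \<in> A" "w \<in> carrier G" using atomsD by blast+
  let ?v = "inv w \<otimes> ?h"
  have v: "?v \<in> A" "w \<otimes> ?v = ?h" using ranktwo_factor[OF h2(2) wA(1)] atomsD(3)[OF wa(1)] by auto
  have "?v \<in> atoms ?h" using atoms_of_product(2)[OF wA(1) v(1)] v h2 by simp
  moreover have "?v \<noteq> x" using v(2) xy(4) wa(3) wA c by (metis right_cancel)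
  moreover have "?v \<noteq> y" using v(2) wa(2) wA c by (metis right_cancel)
  ultimately have "?v = w" using w by blast
  then have ww: "w \<otimes> w = ?h" using v by simp
  show False
  proof (cases "f x \<le> f y")
    case True
    then show False using unique_ascent[OF xy(5) wA(1) wA(1) xy(1,2) ww] wa by simp
  next
    case False
    then show False using unique_ascent[OF xy(5) wA(1) wA(1) xy(2,1) ww] wa xy(4) by simp
  qed
qed

lemma braid_chain_of_unique_cover:
  assumes a: "a \<in> atoms c" and b: "b \<in> A"
    and covers: "{h. covered_by (factorization_poset G A c) below a h} - {a \<otimes> a} = {g\<^sub>a}"
    and c_eq: "c = a \<otimes> b [^] N" and len_c: "len c = Suc N" and N: "2 \<le> N"
    and card: "card (atoms g\<^sub>a) = 3"
    and tcc: "totally_chain_connected (factorization_poset G A c) below"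
  shows "braid_chain G A c r f a b N"
proof -
  note cc = c_carrier
  have aA: "a \<in> A" "a \<in> carrier G" and bc: "b \<in> carrier G" and ac: "a \<preceq> c"
    using a b atomsD A_carrier by blast+
  have cover: "a \<otimes> y = a \<otimes> a \<or> a \<otimes> y = g\<^sub>a"
    if "y \<in> A" "a \<otimes> y \<preceq> c" "len (a \<otimes> y) = 2" for y
    using covered_by_mult[OF aA(2) that(1) cc that(2)] that(3) aA covers by auto
  have suffix: "a \<otimes> y \<preceq> c" "len (a \<otimes> y) = 2" if "y \<in> atoms (b [^] N)" for y
    using below_mult_mono[of a "b [^] N" y] atomsD[OF that] ac aA bc c_eq by auto
  have len_b: "len (b [^] k) = k" "b [^] k \<preceq> b [^] N" if "k \<le> N" for k
  proof -
    have "len c \<le> len a + len (b [^] N)" using len_mult_le[OF aA(2), of "b [^] N"] bc c_eq by simp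
    then have "len (b [^] N) = N" using len_c aA len_pow_le[OF b, of N] by simp
    moreover have "b [^] N = \<one> \<otimes> (b [^] k \<otimes> b [^] (N - k))" using that bc by (simp add: nat_pow_mult)
    ultimately show "len (b [^] k) = k" "b [^] k \<preceq> b [^] N"
      using middle_factor[of \<one> "b [^] k" "b [^] (N - k)" 0 k "N - k"] bc that
        len_pow_le[OF b, of k] len_pow_le[OF b, of "N - k"] by auto
  qed
  have b_atom: "b \<in> atoms (b [^] N)" using len_b(2)[of 1] N b bc by (simp add: gens_below_def)
  have ab: "a \<otimes> b \<preceq> c" "len (a \<otimes> b) = 2" using suffix[OF b_atom] by auto
  have g_cov: "covered_by (factorization_poset G A c) below a g\<^sub>a" and g_ne: "g\<^sub>a \<noteq> a \<otimes> a"
    using covers by blast+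
  \<comment> \<open>If \<open>a = b\<close>, then \<open>c\<close> is a power of \<open>a\<close>
    and \<open>cj a\<close> permutes the covers of \<open>a\<close>. It therefore fixes
    \<open>g\<^sub>a = a \<otimes> y\<close>, so \<open>y\<close> commutes with \<open>a\<close>,
    contrary to \<open>commuting_pair_atoms\<close>.\<close>
  have a_neq_b: "a \<noteq> b"
  proof
    assume eq: "a = b"
    have g: "g\<^sub>a \<in> carrier G" "g\<^sub>a \<preceq> c" "a \<preceq> g\<^sub>a" "a \<noteq> g\<^sub>a"
      and between: "\<And>z. z \<in> carrier G \<Longrightarrow> z \<preceq> c \<Longrightarrow> a \<preceq> z \<Longrightarrow> z \<preceq> g\<^sub>a \<Longrightarrow> z = a \<or> z = g\<^sub>a"
      using g_cov by (auto simp: covered_by_def factorization_poset_eq)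
    obtain z where z: "z \<in> carrier G" "g\<^sub>a = a \<otimes> z" using belowE[OF g(3) aA(2) g(1)] .
    then obtain y where y: "y \<in> atoms z" using atoms_nonempty[of z] g(4) aA by auto
    then have yA: "y \<in> A" "y \<in> carrier G" "y \<preceq> z" using atomsD by auto
    have ay: "a \<otimes> y \<preceq> g\<^sub>a" "len (a \<otimes> y) = 2"
      using below_mult_mono[OF aA(2) z(1) yA(2) _ yA(3)] g z aA yA by auto
    have "a \<preceq> a \<otimes> y" using ay aA yA by (simp add: below_mult_iff)
    moreover have "a \<otimes> y \<preceq> c" using below_trans[OF ay(1) g(2)] aA yA g cc by simp
    moreover have "a \<otimes> y \<noteq> a" using ay aA by auto
    ultimately have gy: "g\<^sub>a = a \<otimes> y" using between[of "a \<otimes> y"] ay aA yA by auto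
    have "y \<noteq> a" using gy g_ne by auto
    have "a \<otimes> a [^] N = a [^] N \<otimes> a" using aA by (metis nat_pow_Suc nat_pow_Suc2)
    then have "cj a (a [^] N) = a [^] N" using aA by (intro cj_eqI) auto
    then have "cj a c = c" using aA eq c_eq by (simp add: cj_mult)
    then have "cj a (a \<otimes> y) \<preceq> c"
      using below_cj_iff[OF aA(2) _ cc, of "a \<otimes> y"] g gy aA yA by simp
    then have "a \<otimes> cj a y = a \<otimes> a \<or> a \<otimes> cj a y = g\<^sub>a"
      using cover[of "cj a y"] ay aA yA cj_in_A len_cj[of a "a \<otimes> y"] by (simp add: cj_mult)
    moreover have "cj a y \<noteq> a" using cj_inject[of a y a] \<open>y \<noteq> a\<close> aA yA by auto
    ultimately have "a \<otimes> cj a y = a \<otimes> y" using gy aA yA by simp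
    then have "a \<otimes> y = y \<otimes> a" using mult_cj aA yA by simp
    moreover have "a \<otimes> y \<in> ranktwo c" using g gy ay aA yA by (simp add: rank_two_below_def)
    ultimately show False using commuting_pair_atoms[OF aA(1) yA(1)] \<open>y \<noteq> a\<close> card gy by simp
  qed
  have g_eq: "g\<^sub>a = a \<otimes> b" using cover[OF b ab] a_neq_b aA bc by auto
  have h: "a \<otimes> b \<in> ranktwo c" "a \<otimes> b \<in> ranktwo (a \<otimes> b)"
    using ab aA bc by (auto simp: rank_two_below_def)
  define d where "d = cj b a"
  have dA: "d \<in> A" "d \<in> carrier G" using aA bc by (auto simp: d_def cj_in_A)
  have bd: "b \<otimes> d = a \<otimes> b" using aA bc by (simp add: d_def mult_cj)
  have "d \<noteq> b" using cj_inject[of b a b] a_neq_b aA bc by (auto simp: d_def)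
  \<comment> \<open>Otherwise \<open>a\<close> and \<open>b\<close> would commute, against the count
    of three atoms.\<close>
  have "d \<noteq> a" using bd commuting_pair_atoms[OF aA(1) b a_neq_b _ h(1)] card g_eq by metis
  have "{a, b, d} \<subseteq> atoms (a \<otimes> b)"
    using atoms_of_product[OF aA(1) b ab(2)] atoms_of_product(2)[OF b dA(1)] bd ab by simp
  moreover have "card {a, b, d} = 3" using a_neq_b \<open>d \<noteq> a\<close> \<open>d \<noteq> b\<close> by simp
  moreover have "finite (atoms (a \<otimes> b))" using card g_eq card.infinite by force
  ultimately have atoms_ab: "atoms (a \<otimes> b) = {a, b, d}" using card g_eq card_subset_eq by metis
  let ?v = "inv d \<otimes> (a \<otimes> b)"
  have v: "?v \<in> A" "d \<otimes> ?v = a \<otimes> b"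
    using ranktwo_factor[OF h(2) dA(1)] atomsD(3)[of d "a \<otimes> b"] atoms_ab by auto
  \<comment> \<open>The cofactor of \<open>d\<close> is one of three atoms, and cancellation
    excludes \<open>b\<close> and \<open>d\<close>; the remaining value \<open>a\<close> gives the
    last braid equation.\<close>
  have "?v \<in> {a, b, d}" using atoms_of_product(2)[OF dA(1) v(1)] v ab atoms_ab by simp
  moreover have "?v \<noteq> b" using v(2) \<open>d \<noteq> a\<close> aA bc dA by (metis right_cancel)
  moreover have "?v \<noteq> d" using v(2) bd \<open>d \<noteq> b\<close> bc dA by (metis right_cancel)
  ultimately have "d \<otimes> a = a \<otimes> b" using v by auto
  then have tri: "tri a b d" using aA b dA bd by (simp add: tri_def)
  \<comment> \<open>Multiplying an atom of \<open>b [^] N\<close> by \<open>a\<close> on the left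
    gives a cover of \<open>a\<close>, and only \<open>a \<otimes> a\<close> and
    \<open>a \<otimes> b\<close> are possible.\<close>
  have two: "y = a \<or> y = b" if "y \<in> atoms (b [^] N)" for y
    using cover[OF atomsD(1)[OF that] suffix[OF that]] g_eq atomsD(2)[OF that] aA bc by auto
  \<comment> \<open>Conjugation by \<open>b\<close> fixes \<open>b [^] N\<close>, so with
    \<open>a\<close> also \<open>d\<close> would be an atom, which \<open>two\<close>
    forbids.\<close>
  have "a \<notin> atoms (b [^] N)"
  proof
    assume "a \<in> atoms (b [^] N)"
    then have "d \<in> atoms (cj b (b [^] N))" using atoms_cj bc by (simp add: d_def)
    moreover have "b \<otimes> b [^] N = b [^] N \<otimes> b" using bc by (metis nat_pow_Suc nat_pow_Suc2)
    then have "cj b (b [^] N) = b [^] N" using bc by (intro cj_eqI) auto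
    ultimately show False using two[of d] \<open>d \<noteq> a\<close> \<open>d \<noteq> b\<close> by simp
  qed
  then have "atoms (b [^] k) \<subseteq> {b}" if "k \<le> N" for k
    using two atoms_mono(1)[OF len_b(2)[OF that]] bc by auto
  then show ?thesis
    using aA b a_neq_b tri atoms_ab c_eq len_c N tcc by unfold_locales (auto simp: d_def)
qed

end

text \<open>Each atom is numbered by its position, the count of atoms at or below it; in a finite
  linear order this is strictly monotone.\<close>

lemma (in conj_gen_group) labelled_of_compatible:
  assumes c: "c \<in> carrier G" and fin: "finite (atoms c)" and comp: "compatible_order G A c r"
  shows "labelled G A c r (\<lambda>x. card {z \<in> atoms c. (z, x) \<in> r})"
proof -
  let ?f = "\<lambda>x. card {z \<in> atoms c. (z, x) \<in> r}"
  have lin: "linear_order_on (atoms c) r" using comp by (simp add: compatible_order_def)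
  then have total: "x \<in> atoms c \<Longrightarrow> y \<in> atoms c \<Longrightarrow> (x, y) \<in> r \<or> (y, x) \<in> r" for x y
    by (metis linear_order_on_def partial_order_on_def preorder_on_def refl_onD total_on_def)
  have tr: "trans r" and anti: "antisym r"
    using lin by (auto simp: linear_order_on_def partial_order_on_def preorder_on_def)
  have le: "(x, y) \<in> r \<longleftrightarrow> ?f x \<le> ?f y" if xy: "x \<in> atoms c" "y \<in> atoms c" for x y
  proof
    assume "(x, y) \<in> r"
    then show "?f x \<le> ?f y" using fin tr by (intro card_mono) (auto dest: transD)
  next
    assume le: "?f x \<le> ?f y"
    show "(x, y) \<in> r"
    proof (rule ccontr)
      assume n: "(x, y) \<notin> r"
      then have yx: "(y, x) \<in> r" using total xy by blast
      have "{z \<in> atoms c. (z, y) \<in> r} \<subseteq> {z \<in> atoms c. (z, x) \<in> r}"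
        using transD[OF tr _ yx] by blast
      moreover have "x \<in> {z \<in> atoms c. (z, x) \<in> r}" "x \<notin> {z \<in> atoms c. (z, y) \<in> r}"
        using n xy total[of x x] by auto
      ultimately have "{z \<in> atoms c. (z, y) \<in> r} \<subset> {z \<in> atoms c. (z, x) \<in> r}" by blast
      then have "?f y < ?f x" using fin by (intro psubset_card_mono) auto
      then show False using le by simp
    qed
  qed
  show ?thesis
  proof unfold_locales
    show "inj_on ?f (atoms c)"
    proof (rule inj_onI)
      fix x y assume "x \<in> atoms c" "y \<in> atoms c" "?f x = ?f y"
      then have "(x, y) \<in> r" "(y, x) \<in> r" using le[of x y] le[of y x] by auto
      then show "x = y" using anti by (simp add: antisymD)
    qed
    fix h x y x' y'
    assume h: "h \<in> ranktwo c" and A: "x \<in> A" "y \<in> A" "x' \<in> A" "y' \<in> A"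
      and e: "x \<otimes> y = h" "x' \<otimes> y' = h" and asc: "?f x \<le> ?f y" "?f x' \<le> ?f y'"
    have ats: "x \<in> atoms c" "y \<in> atoms c" "x' \<in> atoms c" "y' \<in> atoms c"
      using ranktwo_product_atoms[of x y c] ranktwo_product_atoms[of x' y' c] h A e c by auto
    \<comment> \<open>Both pairs are reduced and weakly ascending, so unique existence identifies
      them.\<close>
    have "reduced_factorization G A h [fst p, snd p] \<and> (fst p, snd p) \<in> r"
      if "p = (x, y) \<or> p = (x', y')" for p
      using that A e ats asc le[of x y] le[of x' y'] ranktwoD(3)[OF h]
      by (auto simp: reduced_factorization_def A_carrier)
    moreover have "\<exists>!p. reduced_factorization G A h [fst p, snd p] \<and> (fst p, snd p) \<in> r"
      using comp h by (auto simp: compatible_order_def)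
    ultimately have "(x, y) = (x', y')" by blast
    then show "x = x'" by simp
  qed (use c fin le in auto)
qed

theorem theorem6p12:
  fixes G :: "('a, 'm) monoid_scheme" (structure)
    and A :: "'a set" and c a b g\<^sub>a :: 'a and n :: nat and prec :: "'a rel"
  assumes "group G"
    and "generated_as_monoid_by G A"
    and "\<one> \<notin> A"
    and "conjugation_closed G A"
    and "c \<in> carrier G"
    and "finite (gens_below G A c)"
    and "n = word_length G A c" and "n \<ge> 3"
    and "a \<in> gens_below G A c"
    and "{h. covered_by (factorization_poset G A c) (prefix_le G A) a h} - {a \<otimes> a} = {g\<^sub>a}"
    and "b \<in> A" and "c = a \<otimes> b [^] (n - 1)"
    and "card (gens_below G A g\<^sub>a) = 3"
    and "totally_chain_connected (factorization_poset G A c) (prefix_le G A)"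
    and "compatible_order G A c prec"
  shows "\<forall>g\<in>factorization_poset G A c.
           induces_linear_order
             (reduced_cycle_graph G A (Restr prec (gens_below G A g)) g)"
proof
  fix g
  assume g: "g \<in> factorization_poset G A c"
  interpret conj_gen_group G A
    using assms(1-4) by (simp add: conj_gen_group_def conj_gen_group_axioms_def)
  interpret labelled G A c prec "\<lambda>x. card {z \<in> atoms c. (z, x) \<in> prec}"
    using labelled_of_compatible assms(5,6,15) by blast
  interpret braid_chain G A c prec "\<lambda>x. card {z \<in> atoms c. (z, x) \<in> prec}" a b "n - 1"
    using assms(7-14) by (intro braid_chain_of_unique_cover) auto
  show "induces g" using induces_all[OF g] .
qed

end
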